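(* Let $a_1\le a_2\le a_3\le a_4$ be positive integers with $\sum_{i=1}^4\frac1{a_i}=1$, let $S$ be the K3 surface of Fermat type $\sum_{i=1}^4 x_i^{a_i}=0$, and let $G$ be any subgroup with $G_0\subset G\subset G^{\max}$, with mirror dual group $G^T$. Then the Euler number given by the Vafa formula satisfies $$\chi(\widetilde{S/G})=\frac1{|G|}\sum_{(g,h)\in G\times G}\ \prod_{i\in\{1,\dots,4\}:\ g_i=h_i=0}(1-a_i)=24$$ (elements of $G$ in fractional coordinates, empty product equal to $1$), and $$20=h^{1,1}=|\text{untwisted part of }H^{1,1}(\widetilde{S/G})|+|\text{twisted part of }H^{1,1}(\widetilde{S/G})|,$$ where the untwisted part is the set $D^G$ of $G$-invariant deformations and the twisted part is the (disjoint) union of the set $D^{G^T}$ of $G^T$-invariant deformations and the set of $(G^T,G)$-Roan pairs; that is, $$|D^G|+|D^{G^T}|+|\{(G^T,G)\text{-Roan pairs}\}|=20.$$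
   Context: Fix positive integers $a_1\le\dots\le a_4$ with $\sum_i 1/a_i=1$. Groups. $G^{\max}$ is the finite abelian group of diagonal symmetries of $\sum x_i^{a_i}$ of determinant $1$. Elements are written in fractional coordinates: $G^{\max}$ is identified with the set of vectors $g=(g_1,\dots,g_4)$ with $g_i\in\{0,\frac1{a_i},\dots,\frac{a_i-1}{a_i}\}$ and $\sum_i g_i\in\mathbb Z$, with coordinatewise addition modulo $1$; $g$ corresponds to the diagonal matrix with entries $\exp(2\pi\sqrt{-1}\,g_i)$. $G_0\subset G^{\max}$ is the cyclic subgroup generated by $(\frac1{a_1},\dots,\frac1{a_4})$. Mirror dual group. For $G_0\subset G\subset G^{\max}$, $G^T=\{g'\in G^{\max}: \sum_i g_i a_i g'_i\in\mathbb Z \text{ for all } g\in G\}$. Level. An element $g$ (with coordinates in $[0,1)$) has level $k$ if $\sum_i g_i=k$ (sum in $\mathbb Q$). Invariant deformations. $D^G$ is the set of $s\in\mathbb Z^4$ with $0\le s_i\le a_i-2$ for all $i$, $\sum_i \frac{s_i}{a_i}=1$, and $(\frac{s_1}{a_1},\dots,\frac{s_4}{a_4})\in G^T$. $D^{G^T}$ is the analogous set with the condition $(\frac{s_1}{a_1},\dots,\frac{s_4}{a_4})\in G$. Roan pairs. For a subgroup $H$ of $G^{\max}$, $H_{2Z}$ is the set of level one elements of $H$ having exactly two zero coordinates. A $(G^T,G)$-Roan pair is a pair $(\mathbf z',\mathbf z)\in G^T_{2Z}\times G_{2Z}$ with $\sum_i z'_i a_i z_i=0$ (coordinates in $[0,1)$,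 sum in $\mathbb Q$). *)

theory Defs
  imports "HOL-Algebra.Generated_Groups" Complex_Main
begin

text \<open>
  The exponents \<open>a\<^sub>1, \<dots>, a\<^sub>4\<close> are a function \<open>a\<close> of which only the values on \<open>{1..4}\<close> matter.
  Vectors indexed by \<open>{1..4}\<close> are functions that are \<^const>\<open>undefined\<close> outside \<open>{1..4}\<close>
  (as in \<^const>\<open>PiE\<close>), so that equality of functions is equality of vectors and cardinalities of
  sets of vectors are the expected ones.  A diagonal symmetry with entries
  \<open>exp (2\<pi>\<surd>(-1) g\<^sub>i)\<close> is represented by its rational vector \<open>g\<close> of fractional coordinates,
  and determinant one means that the coordinate sum is an integer.
\<close>

definition Gmax :: "(nat \<Rightarrow> nat) \<Rightarrow> (nat \<Rightarrow> rat) monoid" where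
  "Gmax a =
    \<lparr>carrier = {g \<in> (\<Pi>\<^sub>E i\<in>{1..4}. {of_nat k / of_nat (a i) | k. k < a i}). (\<Sum>i=1..4. g i) \<in> \<int>},
     mult = (\<lambda>g h. \<lambda>i\<in>{1..4}. frac (g i + h i)),
     one = (\<lambda>i\<in>{1..4}. 0)\<rparr>"

lemma comm_group_Gmax:
  assumes pos: "\<And>i. i \<in> {1..4} \<Longrightarrow> a i > 0"
  shows "comm_group (Gmax a)"
proof -
  have grid: "frac x \<in> {of_nat k / of_nat n | k. k < n}"
    if n: "n > 0" and x: "x * of_nat n \<in> \<int>" for n :: nat and x :: rat
  proof -
    obtain m where m: "x * of_nat n = of_int m"
      using x by (auto elim: Ints_cases)
    have m': "of_int m = of_nat n * of_int (m div int n) + (of_int (m mod int n) :: rat)"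
      by (metis mult_div_mod_eq of_int_add of_int_mult of_int_of_nat_eq)
    have "frac x = of_int (m mod int n) / of_nat n"
    proof -
      have "x = of_int (m div int n) + of_int (m mod int n) / of_nat n"
        using m m' n by (simp add: field_simps)
      moreover have "(of_int (m mod int n) :: rat) < of_nat n"
        using n by (metis of_int_less_iff of_int_of_nat_eq of_nat_0_less_iff pos_mod_bound)
      moreover have "(0::rat) \<le> of_int (m mod int n)"
        using n by simp
      ultimately show ?thesis
        using n by (auto simp: frac_unique_iff)
    qed
    moreover have "of_int (m mod int n) = (of_nat (nat (m mod int n)) :: rat)"
      using n by simp
    moreover have "nat (m mod int n) < n"
      using n by (simp add: nat_less_iff)
    ultimately show ?thesis
      unfolding mem_Collect_eq by metis
  qed
  have carrierI: "(\<lambda>i\<in>{1..4}. frac (f i)) \<in> carrier (Gmax a)"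
    if f: "\<And>i. i \<in> {1..4} \<Longrightarrow> f i * of_nat (a i) \<in> \<int>" and s: "(\<Sum>i=1..4. f i) \<in> \<int>" for f
  proof -
    have "(\<Sum>i=1..4. frac (f i)) = (\<Sum>i=1..4. f i) - of_int (\<Sum>i=1..4. \<lfloor>f i\<rfloor>)"
      by (simp add: frac_def sum_subtractf)
    then have "(\<Sum>i=1..4. frac (f i)) \<in> \<int>"
      using s by (metis Ints_diff Ints_of_int)
    moreover have "frac (f i) \<in> {of_nat k / of_nat (a i) | k. k < a i}" if "i \<in> {1..4}" for i
      using grid[OF pos[OF that] f[OF that]] .
    ultimately show ?thesis
      by (simp add: Gmax_def PiE_def Pi_def)
  qed
  have int: "g i * of_nat (a i) \<in> \<int>" and bounds: "0 \<le> g i" "g i < 1"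
    if g: "g \<in> carrier (Gmax a)" and i: "i \<in> {1..4}" for g i
  proof -
    obtain k where "g i = of_nat k / of_nat (a i)" "k < a i"
      using g i by (fastforce simp: Gmax_def PiE_def Pi_def)
    then show "g i * of_nat (a i) \<in> \<int>" "0 \<le> g i" "g i < 1"
      using pos[OF i] by auto
  qed
  have ext: "g \<in> extensional {1..4}" and sum: "(\<Sum>i=1..4. g i) \<in> \<int>"
    if "g \<in> carrier (Gmax a)" for g
    using that by (auto simp: Gmax_def PiE_def)
  have mult: "x \<otimes>\<^bsub>Gmax a\<^esub> y = (\<lambda>i\<in>{1..4}. frac (x i + y i))" for x y
    by (simp add: Gmax_def)
  have one: "\<one>\<^bsub>Gmax a\<^esub> = (\<lambda>i\<in>{1..4}. 0)"
    by (simp add: Gmax_def)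
  have frac_id: "frac (g i) = g i" if "g \<in> carrier (Gmax a)" "i \<in> {1..4}" for g i
    using bounds[OF that] by (simp add: frac_eq)
  have frac_add: "frac (frac x + y) = frac (x + y)" "frac (x + frac y) = frac (x + y)"
    for x y :: rat
  proof -
    have *: "frac (u - of_int k) = frac u" for u :: rat and k :: int
      by (simp add: frac_def)
    have "frac x + y = (x + y) - of_int \<lfloor>x\<rfloor>" "x + frac y = (x + y) - of_int \<lfloor>y\<rfloor>"
      by (simp_all add: frac_def)
    then show "frac (frac x + y) = frac (x + y)" "frac (x + frac y) = frac (x + y)"
      by (simp_all only: *)
  qed
  show ?thesis
  proof (rule comm_groupI)
    fix x y assume x: "x \<in> carrier (Gmax a)" and y: "y \<in> carrier (Gmax a)"
    show "x \<otimes>\<^bsub>Gmax a\<^esub> y \<in> carrier (Gmax a)"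
      unfolding mult using int[OF x] int[OF y] sum[OF x] sum[OF y]
      by (intro carrierI) (simp_all add: distrib_right sum.distrib)
    show "x \<otimes>\<^bsub>Gmax a\<^esub> y = y \<otimes>\<^bsub>Gmax a\<^esub> x"
      by (simp add: mult add.commute)
    fix z
    show "x \<otimes>\<^bsub>Gmax a\<^esub> y \<otimes>\<^bsub>Gmax a\<^esub> z = x \<otimes>\<^bsub>Gmax a\<^esub> (y \<otimes>\<^bsub>Gmax a\<^esub> z)"
      unfolding mult by (intro restrict_ext) (simp add: frac_add add.assoc)
  next
    show "\<one>\<^bsub>Gmax a\<^esub> \<in> carrier (Gmax a)"
      unfolding one using carrierI[of "\<lambda>_. 0"] by simp
  next
    fix x assume x: "x \<in> carrier (Gmax a)"
    show "\<one>\<^bsub>Gmax a\<^esub> \<otimes>\<^bsub>Gmax a\<^esub> x = x"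
      unfolding mult one
      by (rule extensionalityI[OF _ ext[OF x]]) (simp_all add: frac_id[OF x])
    have "(\<lambda>i\<in>{1..4}. frac (- x i)) \<in> carrier (Gmax a)"
      using int[OF x] sum[OF x] by (intro carrierI) (simp_all add: sum_negf)
    moreover have "(\<lambda>i\<in>{1..4}. frac (- x i)) \<otimes>\<^bsub>Gmax a\<^esub> x = \<one>\<^bsub>Gmax a\<^esub>"
      unfolding mult one by (intro restrict_ext) (simp add: frac_add)
    ultimately show "\<exists>y\<in>carrier (Gmax a). y \<otimes>\<^bsub>Gmax a\<^esub> x = \<one>\<^bsub>Gmax a\<^esub>"
      by blast
  qed
qed

definition G0 :: "(nat \<Rightarrow> nat) \<Rightarrow> (nat \<Rightarrow> rat) set" where
  "G0 a = generate (Gmax a) {\<lambda>i\<in>{1..4}. 1 / of_nat (a i)}"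

definition mirror_dual :: "(nat \<Rightarrow> nat) \<Rightarrow> (nat \<Rightarrow> rat) set \<Rightarrow> (nat \<Rightarrow> rat) set" where
  "mirror_dual a G =
    {g' \<in> carrier (Gmax a). \<forall>g\<in>G. (\<Sum>i=1..4. g i * of_nat (a i) * g' i) \<in> \<int>}"

definition has_level :: "(nat \<Rightarrow> rat) \<Rightarrow> nat \<Rightarrow> bool" where
  "has_level g k \<longleftrightarrow> (\<Sum>i=1..4. g i) = of_nat k"

text \<open>
  \<open>deformations a H\<close> requires \<open>(s\<^sub>1/a\<^sub>1, \<dots>, s\<^sub>4/a\<^sub>4) \<in> H\<close>.  The \<open>G\<close>-invariant deformations are thus
  obtained for \<open>H = G\<^sup>T\<close>, and the \<open>G\<^sup>T\<close>-invariant ones for \<open>H = G\<close> itself.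
\<close>

definition deformations :: "(nat \<Rightarrow> nat) \<Rightarrow> (nat \<Rightarrow> rat) set \<Rightarrow> (nat \<Rightarrow> int) set" where
  "deformations a H =
    {s \<in> (\<Pi>\<^sub>E i\<in>{1..4}. {0..int (a i) - 2}).
       (\<Sum>i=1..4. (of_int (s i) / of_nat (a i) :: rat)) = 1 \<and>
       (\<lambda>i\<in>{1..4}. of_int (s i) / of_nat (a i)) \<in> H}"

definition D_G :: "(nat \<Rightarrow> nat) \<Rightarrow> (nat \<Rightarrow> rat) set \<Rightarrow> (nat \<Rightarrow> int) set" where
  "D_G a G = deformations a (mirror_dual a G)"

definition D_GT :: "(nat \<Rightarrow> nat) \<Rightarrow> (nat \<Rightarrow> rat) set \<Rightarrow> (nat \<Rightarrow> int) set" where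
  "D_GT a G = deformations a G"

definition two_zeros :: "(nat \<Rightarrow> rat) set \<Rightarrow> (nat \<Rightarrow> rat) set" where
  "two_zeros H = {z \<in> H. has_level z 1 \<and> card {i \<in> {1..4}. z i = 0} = 2}"

definition roan_pairs :: "(nat \<Rightarrow> nat) \<Rightarrow> (nat \<Rightarrow> rat) set \<Rightarrow> ((nat \<Rightarrow> rat) \<times> (nat \<Rightarrow> rat)) set" where
  "roan_pairs a G =
    {(z', z) \<in> two_zeros (mirror_dual a G) \<times> two_zeros G.
       (\<Sum>i=1..4. z' i * of_nat (a i) * z i) = 0}"

definition vafa_euler :: "(nat \<Rightarrow> nat) \<Rightarrow> (nat \<Rightarrow> rat) set \<Rightarrow> rat" where
  "vafa_euler a G =
    1 / of_nat (card G) *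
    (\<Sum>(g, h)\<in>G \<times> G. \<Prod>i\<in>{i \<in> {1..4}. g i = 0 \<and> h i = 0}. 1 - of_nat (a i))"

definition untwisted_H11 :: "(nat \<Rightarrow> nat) \<Rightarrow> (nat \<Rightarrow> rat) set \<Rightarrow> (nat \<Rightarrow> int) set" where
  "untwisted_H11 a G = D_G a G"

definition twisted_H11 ::
    "(nat \<Rightarrow> nat) \<Rightarrow> (nat \<Rightarrow> rat) set \<Rightarrow> ((nat \<Rightarrow> int) + (nat \<Rightarrow> rat) \<times> (nat \<Rightarrow> rat)) set" where
  "twisted_H11 a G = D_GT a G <+> roan_pairs a G"

definition h11 :: "(nat \<Rightarrow> nat) \<Rightarrow> (nat \<Rightarrow> rat) set \<Rightarrow> nat" where
  "h11 a G = card (untwisted_H11 a G) + card (twisted_H11 a G)"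

end

theory Submission
  imports Defs
begin

text \<open>
  For \<open>J \<subseteq> {1..4}\<close> let \<open>n\<^sub>J\<close> be the number of elements of \<open>G\<close> vanishing on \<open>J\<close>.  Because \<open>G\<close>
  contains \<open>e = (1/a\<^sub>1, \<dots>, 1/a\<^sub>4)\<close>, every coordinate is equidistributed on \<open>G\<close>, so \<open>n\<^sub>i = |G|/a\<^sub>i\<close>,
  and the image of \<open>G\<close> in \<open>\<int>/a\<^sub>i \<times> \<int>/a\<^sub>j\<close> is \<open>{(x, y). [x = y] (mod p\<^sub>i\<^sub>j)}\<close> for some
  \<open>p\<^sub>i\<^sub>j\<close> dividing \<open>a\<^sub>i\<close> and \<open>a\<^sub>j\<close>; hence \<open>p\<^sub>i\<^sub>j |G| = a\<^sub>i a\<^sub>j n\<^sub>i\<^sub>j\<close>.  Moreover \<open>p\<^sub>i\<^sub>j\<close> is the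
  number of elements of \<open>G\<^sup>T\<close> supported on \<open>{i, j}\<close>.

  Expanding the product in the Vafa formula over subsets of the common zeros, the terms for triples and
  for the quadruple cancel by \<open>\<Sum> 1/a\<^sub>i = 1\<close>, as do those for \<open>\<emptyset>\<close> and the singletons, and
  \<open>\<Sum>\<^sub>i\<^sub><\<^sub>j n\<^sub>i\<^sub>j p\<^sub>i\<^sub>j\<close> remains.  That this sum is \<open>24\<close> follows by evaluating
  \<open>\<Sum>\<^sub>g (\<Sum>\<^sub>i ((g\<^sub>i)))\<^sup>2\<close> in two ways, where \<open>((x))\<close> is the sawtooth function.  Finally, inclusion-exclusion
  gives \<open>\<Sum> n\<^sub>i\<^sub>j - 3\<close> elements of \<open>G\<close> without zero coordinates; apart from \<open>e\<close> and \<open>-e\<close> they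
  have level two, and subtracting \<open>e\<close> turns them into the \<open>G\<^sup>T\<close>-invariant deformations.  The same
  holds for \<open>G\<^sup>T\<close> with \<open>p\<^sub>i\<^sub>j\<close> in place of \<open>n\<^sub>i\<^sub>j\<close>, and there are
  \<open>\<Sum> (n\<^sub>i\<^sub>j - 1) (p\<^sub>i\<^sub>j - 1)\<close> Roan pairs, so the total is
  \<open>\<Sum> n\<^sub>i\<^sub>j p\<^sub>i\<^sub>j + 6 - 10 = 20\<close>.
\<close>

section \<open>Sums over the four coordinates and over the six coordinate pairs\<close>

lemma atLeastAtMost_1_4: "{1..4::nat} = {1, 2, 3, 4}"
  by auto

lemma sum_1_4: "(\<Sum>i=1..4. f i) = f 1 + f 2 + f 3 + f (4::nat)"
  for f :: "nat \<Rightarrow> 'a::comm_monoid_add"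
  unfolding atLeastAtMost_1_4 by (simp add: add.assoc)

lemma prod_1_4: "(\<Prod>i=1..4. f i) = f 1 * f 2 * f 3 * f (4::nat)"
  for f :: "nat \<Rightarrow> 'a::comm_monoid_mult"
  unfolding atLeastAtMost_1_4 by (simp add: mult.assoc)

lemma ball_1_4: "(\<forall>i\<in>{1..4}. P i) \<longleftrightarrow> P 1 \<and> P 2 \<and> P 3 \<and> P (4::nat)"
  unfolding atLeastAtMost_1_4 by simp

definition coord_pairs :: "(nat \<times> nat) set" where
  "coord_pairs = {(1, 2), (1, 3), (1, 4), (2, 3), (2, 4), (3, 4)}"

lemma sum_coord_pairs:
  "(\<Sum>(i, j)\<in>coord_pairs. f i j) = f 1 2 + f 1 3 + f 1 4 + f 2 3 + f 2 4 + f 3 4"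
  for f :: "nat \<Rightarrow> nat \<Rightarrow> 'b::comm_monoid_add"
  by (simp add: coord_pairs_def add.assoc)

lemma coord_pairsD: "(i, j) \<in> coord_pairs \<Longrightarrow> i \<in> {1..4} \<and> j \<in> {1..4} \<and> i \<noteq> j"
  by (auto simp: coord_pairs_def)

lemma complement_1_4:
  "{1..4} - {1, 2} = {3, 4::nat}" "{1..4} - {1, 3} = {2, 4::nat}" "{1..4} - {1, 4} = {2, 3::nat}"
  "{1..4} - {2, 3} = {1, 4::nat}" "{1..4} - {2, 4} = {1, 3::nat}" "{1..4} - {3, 4} = {1, 2::nat}"
  by auto

lemma coord_pairs_complement:
  assumes "(i, j) \<in> coord_pairs"
  obtains k l where "(k, l) \<in> coord_pairs" "{1..4} - {i, j} = {k, l}"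
proof -
  have "(1, 2) \<in> coord_pairs" "(1, 3) \<in> coord_pairs" "(1, 4) \<in> coord_pairs"
    "(2, 3) \<in> coord_pairs" "(2, 4) \<in> coord_pairs" "(3, 4) \<in> coord_pairs"
    by (simp_all add: coord_pairs_def)
  moreover have "i = 1 \<and> j = 2 \<or> i = 1 \<and> j = 3 \<or> i = 1 \<and> j = 4 \<or>
      i = 2 \<and> j = 3 \<or> i = 2 \<and> j = 4 \<or> i = 3 \<and> j = 4"
    using assms by (simp add: coord_pairs_def)
  ultimately show ?thesis using that complement_1_4 by blast
qed

text \<open>Complementation permutes the six pairs. For the mirror dual this trades vanishing on a
  pair for being supported on it.\<close>

lemma sum_coord_pairs_complement:
  "(\<Sum>(i, j)\<in>coord_pairs. f ({1..4} - {i, j})) = (\<Sum>(i, j)\<in>coord_pairs. f {i, j})"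
  for f :: "nat set \<Rightarrow> 'b::comm_monoid_add"
  by (simp only: complement_1_4 sum_coord_pairs ac_simps)

section \<open>The sawtooth function and its finite sums\<close>

text \<open>Meant for arguments in [0,1); no reduction modulo 1 is built in. The value 0 at 0,
  instead of -1/2, makes it odd modulo 1.\<close>

definition sawtooth :: "rat \<Rightarrow> rat" where
  "sawtooth x = (if x = 0 then 0 else x - 1/2)"

lemma sum_of_nat_lessThan: "(\<Sum>k<m. of_nat k) = (of_nat m * (of_nat m - 1) / 2 :: rat)"
  by (induction m) (auto simp: field_simps)

text \<open>The distribution relation of the sawtooth function: it holds for the linear part x - 1/2
  by summing an arithmetic progression, and the exceptional value at 0 fits in.\<close>

lemma sawtooth_distribution:
  assumes "m > 0" "r < p"
  shows "(\<Sum>k<m. sawtooth (of_nat (r + k * p) / of_nat (p * m))) = sawtooth (of_nat r / of_nat p)"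
proof -
  have p: "p > 0" using assms by simp
  have *: "(\<Sum>k<m. of_nat (r + k * p) / of_nat (p * m) - 1/2) = (of_nat r / of_nat p - 1/2 :: rat)"
  proof -
    have "(\<Sum>k<m. of_nat (r + k * p) / of_nat (p * m) - 1/2) =
        (\<Sum>k<m. of_nat k / of_nat m + (of_nat r / of_nat (p * m) - 1/2 :: rat))"
      using assms p by (intro sum.cong) (auto simp: field_simps)
    also have "\<dots> = of_nat m * (of_nat m - 1) / 2 / of_nat m
        + of_nat m * (of_nat r / of_nat (p * m) - 1/2)"
      by (simp add: sum.distrib sum_of_nat_lessThan flip: sum_divide_distrib)
    also have "\<dots> = of_nat r / of_nat p - 1/2"
      using assms p by (simp add: field_simps)
    finally show ?thesis .
  qed
  show ?thesis
  proof (cases "r = 0")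
    case True
    \<comment> \<open>For r = 0 exactly the term k = 0 meets the exceptional value, which exceeds
      the linear formula by 1/2.\<close>
    have "(\<Sum>k<m. sawtooth (of_nat (r + k * p) / of_nat (p * m))) =
        (\<Sum>k<m. of_nat (r + k * p) / of_nat (p * m) - 1/2 + (if k = 0 then 1/2 else 0))"
      using True p assms by (intro sum.cong) (auto simp: sawtooth_def)
    also have "\<dots> = 0"
      unfolding sum.distrib * using True assms by simp
    finally show ?thesis using True by (simp add: sawtooth_def)
  next
    case False
    have "(\<Sum>k<m. sawtooth (of_nat (r + k * p) / of_nat (p * m))) =
        (\<Sum>k<m. of_nat (r + k * p) / of_nat (p * m) - 1/2)"
      using False p assms by (intro sum.cong) (auto simp: sawtooth_def add_nonneg_eq_0_iff)
    then show ?thesis using * False p by (simp add: sawtooth_def)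
  qed
qed

text \<open>This is the Dedekind sum s(1, p): expand the square, use the power sums of r and r^2,
  and correct the term r = 0 by 1/4.\<close>

lemma sum_sawtooth_sq:
  assumes "p > 0"
  shows "(\<Sum>r<p. (sawtooth (of_nat r / of_nat p))\<^sup>2) =
    (of_nat p - 1) * (of_nat p - 2) / (12 * of_nat p)"
proof -
  have sq: "(\<Sum>r<m. (of_nat r)\<^sup>2) = (of_nat m * (of_nat m - 1) * (2 * of_nat m - 1) / 6 :: rat)" for m
    by (induction m) (auto simp: field_simps power2_eq_square)
  have "(\<Sum>r<p. (sawtooth (of_nat r / of_nat p))\<^sup>2) =
      (\<Sum>r<p. (of_nat r)\<^sup>2 / (of_nat p)\<^sup>2 - of_nat r / of_nat p + 1/4 - (if r = 0 then 1/4 else 0))"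
    using assms by (intro sum.cong) (auto simp: sawtooth_def field_simps power2_eq_square)
  also have "\<dots> = of_nat p * (of_nat p - 1) * (2 * of_nat p - 1) / 6 / (of_nat p)\<^sup>2
      - of_nat p * (of_nat p - 1) / 2 / of_nat p + of_nat p / 4 - 1/4"
    using assms by (simp add: sum.distrib sum_subtractf sq sum_of_nat_lessThan flip: sum_divide_distrib)
  also have "\<dots> = (of_nat p - 1) * (of_nat p - 2) / (12 * of_nat p)"
    using assms by (simp add: field_simps power2_eq_square)
  finally show ?thesis .
qed

section \<open>Sums over fibre products of residue rings\<close>

lemma sum_residue_class:
  fixes f :: "nat \<Rightarrow> 'a::comm_monoid_add"
  assumes "r < p"
  shows "(\<Sum>x | x < p * m \<and> x mod p = r. f x) = (\<Sum>k<m. f (r + k * p))"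
proof (rule sum.reindex_bij_witness[of _ "\<lambda>k. r + k * p" "\<lambda>x. x div p"])
  fix x assume x: "x \<in> {x. x < p * m \<and> x mod p = r}"
  then show "r + x div p * p = x" by (auto simp: mult.commute)
  then show "f (r + x div p * p) = f x" by simp
  show "x div p \<in> {..<m}" using x assms by (auto simp: less_mult_imp_div_less mult.commute)
next
  fix k assume "k \<in> {..<m}"
  then have "r + k * p < p + k * p" "Suc k * p \<le> m * p"
    using assms mult_le_mono1[of "Suc k" m p] by auto
  then have "r + k * p < p * m" by (simp add: mult.commute)
  then show "r + k * p \<in> {x. x < p * m \<and> x mod p = r}" using assms by simp
  show "(r + k * p) div p = k" using assms by simp
qed

text \<open>For p dividing a and b this is the fibre product of Z/a and Z/b over Z/p, written with
  least residues.\<close>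

definition fibre_product :: "nat \<Rightarrow> nat \<Rightarrow> nat \<Rightarrow> (nat \<times> nat) set" where
  "fibre_product p a b = {(x, y). x < a \<and> y < b \<and> x mod p = y mod p}"

lemma finite_fibre_product: "finite (fibre_product p a b)"
  by (rule finite_subset[of _ "{..<a} \<times> {..<b}"]) (auto simp: fibre_product_def)

text \<open>Grouping the points by their common residue r modulo p makes each group a full product
  of two residue classes.\<close>

lemma sum_fibre_product:
  fixes f g :: "nat \<Rightarrow> 'a::comm_semiring_0"
  assumes "p > 0"
  shows "(\<Sum>(x, y)\<in>fibre_product p (p * m) (p * n). f x * g y) =
    (\<Sum>r<p. (\<Sum>k<m. f (r + k * p)) * (\<Sum>k<n. g (r + k * p)))"
proof -
  let ?M = "fibre_product p (p * m) (p * n)"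
  have "(\<Sum>(x, y)\<in>?M. f x * g y) =
      (\<Sum>r<p. \<Sum>(x, y)\<in>{z \<in> ?M. fst z mod p = r}. f x * g y)"
    by (rule sum.group[symmetric]) (use assms in \<open>auto simp: finite_fibre_product\<close>)
  also have "\<dots> = (\<Sum>r<p. \<Sum>(x, y)\<in>{x. x < p * m \<and> x mod p = r} \<times> {y. y < p * n \<and> y mod p = r}.
      f x * g y)"
    by (intro sum.cong) (auto simp: fibre_product_def)
  also have "\<dots> = (\<Sum>r<p. (\<Sum>x | x < p * m \<and> x mod p = r. f x) * (\<Sum>y | y < p * n \<and> y mod p = r. g y))"
    by (simp add: sum_product sum.cartesian_product)
  also have "\<dots> = (\<Sum>r<p. (\<Sum>k<m. f (r + k * p)) * (\<Sum>k<n. g (r + k * p)))"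
    by (intro sum.cong refl) (simp add: sum_residue_class)
  finally show ?thesis .
qed

lemma card_fibre_product:
  assumes "p > 0" "p dvd a" "p dvd b"
  shows "p * card (fibre_product p a b) = a * b"
proof -
  obtain m n where "a = p * m" "b = p * n" using assms by (auto elim!: dvdE)
  moreover have "(\<Sum>(x, y)\<in>fibre_product p (p * m) (p * n). 1 * 1 :: nat) = p * (m * n)"
    by (subst sum_fibre_product) (use assms in auto)
  ultimately show ?thesis by simp
qed

text \<open>The distribution relation collapses both inner sums to the sawtooth at r/p, so only s(1,
  p) is left and a, b drop out.\<close>

lemma sum_sawtooth_fibre_product:
  assumes "p > 0" "p dvd a" "p dvd b" "a > 0" "b > 0"
  shows "(\<Sum>(x, y)\<in>fibre_product p a b. sawtooth (of_nat x / of_nat a) * sawtooth (of_nat y / of_nat b)) =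
    (of_nat p - 1) * (of_nat p - 2) / (12 * of_nat p)"
proof -
  obtain m n where ab: "a = p * m" "b = p * n" using assms by (auto elim!: dvdE)
  have "m > 0" "n > 0" using assms ab by auto
  then show ?thesis
    unfolding ab sum_fibre_product[OF assms(1)] sum_sawtooth_sq[OF assms(1), symmetric] power2_eq_square
    by (intro sum.cong refl) (simp only: sawtooth_distribution lessThan_iff)
qed


text \<open>The sawtooth sum is the level minus half the support size. Without zero coordinates the
  left side is 4, 0, 4 at levels 1, 2, 3; with one zero it is 1, with two or four it is 0, and
  exactly three zeros contradict an integral sum. The right side encodes these values by indicators
  that are easy to sum over a group.\<close>

lemma sawtooth_total_sq:
  assumes "0 \<le> x" "x < 1" "0 \<le> y" "y < 1" "0 \<le> z" "z < 1" "0 \<le> w" "w < 1"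
    and "x + y + z + w \<in> {0, 1, 2, 3}"
  shows "4 * (sawtooth x + sawtooth y + sawtooth z + sawtooth w)\<^sup>2 =
    4 * of_bool (x \<noteq> 0 \<and> y \<noteq> 0 \<and> z \<noteq> 0 \<and> w \<noteq> 0 \<and> x + y + z + w = 1)
    + 4 * of_bool (x + y + z + w = 3)
    + (of_bool (x = 0) + of_bool (y = 0) + of_bool (z = 0) + of_bool (w = 0))
    - 2 * (of_bool (x = 0 \<and> y = 0) + of_bool (x = 0 \<and> z = 0) + of_bool (x = 0 \<and> w = 0)
      + of_bool (y = 0 \<and> z = 0) + of_bool (y = 0 \<and> w = 0) + of_bool (z = 0 \<and> w = 0))
    + 8 * of_bool (x = 0 \<and> y = 0 \<and> z = 0 \<and> w = 0)"
proof -
  define s where "s = x + y + z + w"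
  have saw: "sawtooth u = u - (1 - of_bool (u = 0)) / 2" for u
    by (simp add: sawtooth_def)
  have "sawtooth x + sawtooth y + sawtooth z + sawtooth w =
      s - (4 - of_bool (x = 0) - of_bool (y = 0) - of_bool (z = 0) - of_bool (w = 0)) / 2"
    by (simp add: saw s_def field_simps)
  moreover have "s \<in> {0, 1, 2, 3}" using assms(9) by (simp add: s_def)
  moreover have "4 * (s - (4 - of_bool (x = 0) - of_bool (y = 0) - of_bool (z = 0) - of_bool (w = 0)) / 2)\<^sup>2 =
      4 * of_bool (x \<noteq> 0 \<and> y \<noteq> 0 \<and> z \<noteq> 0 \<and> w \<noteq> 0 \<and> s = 1) + 4 * of_bool (s = 3)
      + (of_bool (x = 0) + of_bool (y = 0) + of_bool (z = 0) + of_bool (w = 0))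
      - 2 * (of_bool (x = 0 \<and> y = 0) + of_bool (x = 0 \<and> z = 0) + of_bool (x = 0 \<and> w = 0)
        + of_bool (y = 0 \<and> z = 0) + of_bool (y = 0 \<and> w = 0) + of_bool (z = 0 \<and> w = 0))
      + 8 * of_bool (x = 0 \<and> y = 0 \<and> z = 0 \<and> w = 0)"
    if "s \<in> {0, 1, 2, 3}"
    using that assms(1-8) s_def
    by (cases "x = 0"; cases "y = 0"; cases "z = 0"; cases "w = 0")
      (auto simp: power2_eq_square)
  ultimately show ?thesis by (simp only: s_def)
qed

lemma frac_diff_left: "frac (frac x - y) = frac (x - y)"
  using frac_add_simps(1)[of x "- y"] by simp

section \<open>The symmetry group in coordinates\<close>

text \<open>A locale, because its results are needed both for \<open>G\<close> and for
  \<open>mirror_dual a G\<close>, which is shown below to satisfy the same assumptions.\<close>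

locale fermat_symmetries =
  fixes a :: "nat \<Rightarrow> nat" and G :: "(nat \<Rightarrow> rat) set"
  assumes pos: "i \<in> {1..4} \<Longrightarrow> a i > 0"
    and recip: "(\<Sum>i=1..4. 1 / of_nat (a i) :: rat) = 1"
    and subgroup: "subgroup G (Gmax a)"
    and G0_subset: "G0 a \<subseteq> G"
begin

text \<open>An exponent 1 would exhaust the sum of reciprocals and leave nothing for another,
  positive, term.\<close>

lemma two_le: "i \<in> {1..4} \<Longrightarrow> 2 \<le> a i"
proof (rule ccontr)
  assume i: "i \<in> {1..4}" and "\<not> 2 \<le> a i"
  then have a: "a i = 1" using pos[OF i] by simp
  define j where "j = (if i = 1 then 2 else 1 :: nat)"
  have j: "j \<in> {1..4}" "i \<noteq> j" by (auto simp: j_def)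
  have "(\<Sum>k\<in>{i, j}. 1 / of_nat (a k) :: rat) \<le> (\<Sum>k=1..4. 1 / of_nat (a k))"
    using i j by (intro sum_mono2) auto
  then show False using j pos[OF j(1)] a recip by simp
qed

lemma Gmax_simps:
  "x \<otimes>\<^bsub>Gmax a\<^esub> y = (\<lambda>i\<in>{1..4}. frac (x i + y i))"
  "\<one>\<^bsub>Gmax a\<^esub> = (\<lambda>i\<in>{1..4}. 0)"
  by (simp_all add: Gmax_def)

lemma group_Gmax: "group (Gmax a)"
  using comm_group_Gmax[OF pos] by (auto simp: comm_group_def)

lemma carrier_nth:
  assumes "g \<in> carrier (Gmax a)" "i \<in> {1..4}"
  obtains k where "k < a i" "g i = of_nat k / of_nat (a i)"
  using assms by (fastforce simp: Gmax_def PiE_def Pi_def)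

lemma carrier_bounds:
  assumes "g \<in> carrier (Gmax a)" "i \<in> {1..4}"
  shows "0 \<le> g i" "g i < 1" "g i * of_nat (a i) \<in> \<int>"
proof -
  obtain k where "k < a i" "g i = of_nat k / of_nat (a i)" using carrier_nth[OF assms] .
  then show "0 \<le> g i" "g i < 1" "g i * of_nat (a i) \<in> \<int>"
    using pos[OF assms(2)] by auto
qed

lemma carrier_sum: "g \<in> carrier (Gmax a) \<Longrightarrow> (\<Sum>i=1..4. g i) \<in> \<int>"
  by (simp add: Gmax_def)

lemma carrier_eqI:
  assumes "g \<in> carrier (Gmax a)" "h \<in> carrier (Gmax a)" "\<And>i. i \<in> {1..4} \<Longrightarrow> g i = h i"
  shows "g = h"
proof (rule extensionalityI)
  show "g \<in> extensional {1..4}" "h \<in> extensional {1..4}"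
    using assms(1,2) by (auto simp: Gmax_def PiE_def)
qed (rule assms(3))

lemma finite_carrier: "finite (carrier (Gmax a))"
proof (rule finite_subset)
  show "carrier (Gmax a) \<subseteq> (\<Pi>\<^sub>E i\<in>{1..4}. (\<lambda>k. of_nat k / of_nat (a i)) ` {..<a i})"
  proof
    fix g assume g: "g \<in> carrier (Gmax a)"
    have "g i \<in> (\<lambda>k. of_nat k / of_nat (a i)) ` {..<a i}" if "i \<in> {1..4}" for i
      using carrier_nth[OF g that] by auto
    moreover have "g \<in> extensional {1..4}"
      using g unfolding Gmax_def PiE_def by simp
    ultimately show "g \<in> (\<Pi>\<^sub>E i\<in>{1..4}. (\<lambda>k. of_nat k / of_nat (a i)) ` {..<a i})"
      unfolding PiE_def Pi_def by blast
  qed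
qed (intro finite_PiE finite_imageI finite_atLeastAtMost finite_lessThan)

lemma carrierI:
  assumes "\<And>i. i \<in> {1..4} \<Longrightarrow> \<exists>k<a i. g i = of_nat k / of_nat (a i)" "(\<Sum>i=1..4. g i) \<in> \<int>"
    "g \<in> extensional {1..4}"
  shows "g \<in> carrier (Gmax a)"
  using assms unfolding Gmax_def PiE_def Pi_def by simp blast

lemma G_carrier: "g \<in> G \<Longrightarrow> g \<in> carrier (Gmax a)"
  using subgroup.subset[OF subgroup] by blast

lemmas G_nth = carrier_nth[OF G_carrier]
lemmas G_bounds = carrier_bounds[OF G_carrier]
lemmas G_sum = carrier_sum[OF G_carrier]
lemmas G_eqI = carrier_eqI[OF G_carrier G_carrier]

lemma finite_G: "finite G"
  using finite_carrier subgroup.subset[OF subgroup] by (rule finite_subset[rotated])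

lemma zero_in: "(\<lambda>i\<in>{1..4}. 0) \<in> G"
  using subgroup.one_closed[OF subgroup] by (simp only: Gmax_simps)

lemma add_in: "g \<in> G \<Longrightarrow> h \<in> G \<Longrightarrow> (\<lambda>i\<in>{1..4}. frac (g i + h i)) \<in> G"
  using subgroup.m_closed[OF subgroup] by (simp only: Gmax_simps)

lemma carrier_inv:
  assumes g: "g \<in> carrier (Gmax a)"
  shows "inv\<^bsub>Gmax a\<^esub> g = (\<lambda>i\<in>{1..4}. frac (- g i))"
proof -
  interpret group "Gmax a" by (rule group_Gmax)
  let ?h = "inv\<^bsub>Gmax a\<^esub> g"
  have h: "?h \<in> carrier (Gmax a)" using g by simp
  have "?h i = frac (- g i)" if i: "i \<in> {1..4}" for i
  proof -
    have "(g \<otimes>\<^bsub>Gmax a\<^esub> ?h) i = \<one>\<^bsub>Gmax a\<^esub> i" using g by simp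
    then have "frac (g i + ?h i) = 0" using i by (simp add: Gmax_simps)
    then have "- (g i + ?h i) \<in> \<int>"
      using Ints_minus frac_eq_0_iff by blast
    then have "frac (- g i) = ?h i"
      using carrier_bounds[OF h i] by (simp add: frac_unique_iff)
    then show ?thesis ..
  qed
  moreover have "?h \<in> extensional {1..4}"
    using h unfolding Gmax_def PiE_def by simp
  ultimately show ?thesis
    by (intro extensionalityI[of _ "{1..4}"]) simp_all
qed

lemma neg_in: "g \<in> G \<Longrightarrow> (\<lambda>i\<in>{1..4}. frac (- g i)) \<in> G"
  using subgroup.m_inv_closed[OF subgroup, of g] by (simp only: carrier_inv[OF G_carrier])

lemma generator_in: "(\<lambda>i\<in>{1..4}. 1 / of_nat (a i)) \<in> G"
  using G0_subset by (auto simp: G0_def intro: generate.incl)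

lemma multiple_in: "(\<lambda>i\<in>{1..4}. frac (of_nat n / of_nat (a i))) \<in> G"
proof (induction n)
  case 0
  then show ?case using zero_in by (simp del: restrict_apply)
next
  case (Suc n)
  have "(\<lambda>i\<in>{1..4}. frac (of_nat (Suc n) / of_nat (a i))) =
      (\<lambda>i\<in>{1..4}. frac ((\<lambda>i\<in>{1..4}. frac (of_nat n / of_nat (a i) :: rat)) i
        + (\<lambda>i\<in>{1..4}. 1 / of_nat (a i)) i))"
    by (intro restrict_ext) (simp add: frac_add_simps add_divide_distrib add.commute)
  then show ?case using add_in[OF Suc generator_in] by (simp only:)
qed

section \<open>Coordinate stabilisers and equidistribution\<close>

definition stab :: "nat set \<Rightarrow> (nat \<Rightarrow> rat) set" where
  "stab J = {g \<in> G. \<forall>i\<in>J. g i = 0}"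

lemma stab_empty: "stab {} = G"
  by (simp add: stab_def)

text \<open>The fibres of the projection to the coordinates in \<open>J\<close> are cosets of its
  kernel; translation by \<open>h\<close> is the bijection.\<close>

lemma card_fibre:
  assumes h: "h \<in> G" and J: "J \<subseteq> {1..4}"
  shows "card {g \<in> G. \<forall>i\<in>J. g i = h i} = card (stab J)"
proof -
  interpret group "Gmax a" by (rule group_Gmax)
  have hc: "h \<in> carrier (Gmax a)" using G_carrier[OF h] .
  have nth: "(g \<otimes>\<^bsub>Gmax a\<^esub> h) i = frac (g i + h i)" "(g \<otimes>\<^bsub>Gmax a\<^esub> inv\<^bsub>Gmax a\<^esub> h) i = frac (g i - h i)"
    if "i \<in> J" for g i
    using that J unfolding Gmax_simps carrier_inv[OF hc] by auto
  have "bij_betw (\<lambda>g. g \<otimes>\<^bsub>Gmax a\<^esub> h) (stab J) {g \<in> G. \<forall>i\<in>J. g i = h i}"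
  proof (rule bij_betw_byWitness[where f' = "\<lambda>g. g \<otimes>\<^bsub>Gmax a\<^esub> inv\<^bsub>Gmax a\<^esub> h"])
    show "(\<lambda>g. g \<otimes>\<^bsub>Gmax a\<^esub> h) ` stab J \<subseteq> {g \<in> G. \<forall>i\<in>J. g i = h i}"
      using subgroup.m_closed[OF subgroup _ h] J G_bounds[OF h] by (auto simp: stab_def nth frac_eq subset_iff)
    show "(\<lambda>g. g \<otimes>\<^bsub>Gmax a\<^esub> inv\<^bsub>Gmax a\<^esub> h) ` {g \<in> G. \<forall>i\<in>J. g i = h i} \<subseteq> stab J"
      using subgroup.m_closed[OF subgroup _ subgroup.m_inv_closed[OF subgroup h]]
      by (auto simp: stab_def nth)
  qed (use hc G_carrier in \<open>auto simp: m_assoc stab_def\<close>)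
  then show ?thesis by (rule bij_betw_same_card[symmetric])
qed

text \<open>Every value k/a_i is attained by the k-fold multiple of the generator, so by
  \<open>card_fibre\<close> all fibres are nonempty and equally large.\<close>

lemma sum_coordinate:
  assumes i: "i \<in> {1..4}"
  shows "(\<Sum>g\<in>G. f (g i)) = of_nat (card (stab {i})) * (\<Sum>k<a i. f (of_nat k / of_nat (a i)) :: rat)"
proof -
  let ?T = "(\<lambda>k. of_nat k / of_nat (a i) :: rat) ` {..<a i}"
  have "(\<Sum>g\<in>G. f (g i)) = (\<Sum>x\<in>?T. \<Sum>g | g \<in> G \<and> g i = x. f (g i))"
    by (rule sum.group[symmetric]) (use finite_G in \<open>auto elim!: G_nth[OF _ i]\<close>)
  also have "\<dots> = (\<Sum>x\<in>?T. of_nat (card (stab {i})) * f x)"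
  proof (intro sum.cong refl)
    fix x assume "x \<in> ?T"
    then obtain k where k: "k < a i" "x = of_nat k / of_nat (a i)" by auto
    then have "card {g \<in> G. g i = x} = card (stab {i})"
      using card_fibre[OF multiple_in[of k], of "{i}"] i by (simp add: frac_eq)
    then show "(\<Sum>g | g \<in> G \<and> g i = x. f (g i)) = of_nat (card (stab {i})) * f x" by simp
  qed
  also have "\<dots> = (\<Sum>k<a i. of_nat (card (stab {i})) * f (of_nat k / of_nat (a i)))"
    using pos[OF i] by (subst sum.reindex) (auto simp: inj_on_def)
  finally show ?thesis by (simp add: sum_distrib_left)
qed

lemma card_stab_single:
  assumes "i \<in> {1..4}"
  shows "of_nat (card (stab {i})) = (of_nat (card G) / of_nat (a i) :: rat)"
  using sum_coordinate[OF assms, of "\<lambda>_. 1"] pos[OF assms] by (simp add: field_simps)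

lemma sum_card_stab_single:
  "(\<Sum>i=1..4. of_nat (card (stab {i}))) = (of_nat (card G) :: rat)"
proof -
  have "(\<Sum>i=1..4. of_nat (card (stab {i}))) =
      (\<Sum>i=1..4. of_nat (card G) * (1 / of_nat (a i)) :: rat)"
    by (intro sum.cong refl) (simp add: card_stab_single)
  then show ?thesis
    using recip by (simp only: mult_1_right flip: sum_distrib_left)
qed

section \<open>The image of the group in two coordinates\<close>

text \<open>The integers d with (d, 0) in the image of \<open>G\<close> in Z/a_i x Z/a_j. They form
  a subgroup of Z, which determines the image because (1, 1) lies in it as well.\<close>

definition steps :: "nat \<Rightarrow> nat \<Rightarrow> int set" where
  "steps i j = {d. \<exists>g\<in>G. g i = frac (of_int d / of_nat (a i)) \<and> g j = 0}"

text \<open>The positive generator of \<open>steps i j\<close>, written p_ij in the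
  overview.\<close>

definition modulus :: "nat \<Rightarrow> nat \<Rightarrow> nat" where
  "modulus i j = (LEAST p. p > 0 \<and> int p \<in> steps i j)"

lemma steps_diff:
  assumes ij: "i \<in> {1..4}" "j \<in> {1..4}" and d: "d \<in> steps i j" "e \<in> steps i j"
  shows "d - e \<in> steps i j"
proof -
  obtain g where g: "g \<in> G" "g i = frac (of_int d / of_nat (a i))" "g j = 0"
    using d by (auto simp: steps_def)
  obtain h where h: "h \<in> G" "h i = frac (of_int e / of_nat (a i))" "h j = 0"
    using d by (auto simp: steps_def)
  have "frac (frac x + frac (- frac y)) = frac (x - y)" for x y :: rat
    by (simp add: frac_neg_frac frac_diff_left)
  then show ?thesis
    unfolding steps_def mem_Collect_eq using g h ij
    by (intro bexI[OF _ add_in[OF g(1) neg_in[OF h(1)]]]) (simp add: diff_divide_distrib del: frac_add_simps)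
qed

lemma steps_exponents:
  assumes ij: "i \<in> {1..4}" "j \<in> {1..4}"
  shows "int (a i) \<in> steps i j" "int (a j) \<in> steps i j"
proof -
  show "int (a i) \<in> steps i j"
    using pos[OF ij(1)] ij unfolding steps_def mem_Collect_eq by (intro bexI[OF _ zero_in]) auto
  \<comment> \<open>The \<open>a j\<close>-fold multiple of the generator vanishes in coordinate j
    and is a_j/a_i modulo 1 in coordinate i.\<close>
  show "int (a j) \<in> steps i j"
    using pos[OF ij(2)] ij unfolding steps_def mem_Collect_eq
    by (intro bexI[OF _ multiple_in[of "a j"]]) auto
qed

lemma modulus_pos:
  assumes "i \<in> {1..4}" "j \<in> {1..4}"
  shows "modulus i j > 0" "int (modulus i j) \<in> steps i j"
  using LeastI[of "\<lambda>p. p > 0 \<and> int p \<in> steps i j" "a i"] pos steps_exponents assms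
  by (auto simp: modulus_def)

text \<open>A subgroup of Z is generated by its least positive element, since the remainder on
  division by it would otherwise be a smaller one.\<close>

lemma steps_iff:
  assumes ij: "i \<in> {1..4}" "j \<in> {1..4}"
  shows "d \<in> steps i j \<longleftrightarrow> int (modulus i j) dvd d"
proof
  let ?p = "int (modulus i j)"
  have mult: "?p * k \<in> steps i j" for k
  proof (induction k rule: int_induct[of _ 0])
    case base
    then show ?case using steps_diff[OF ij modulus_pos(2)[OF ij] modulus_pos(2)[OF ij]] by simp
  next
    case (step1 k)
    have "0 - ?p \<in> steps i j"
      using steps_diff[OF ij steps_diff[OF ij modulus_pos(2)[OF ij] modulus_pos(2)[OF ij]]
        modulus_pos(2)[OF ij]] by simp
    from steps_diff[OF ij step1(2) this] show ?case by (simp add: algebra_simps)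
  next
    case (step2 k)
    from steps_diff[OF ij step2(2) modulus_pos(2)[OF ij]] show ?case by (simp add: algebra_simps)
  qed
  then show "d \<in> steps i j" if "?p dvd d" using that by (auto elim: dvdE)
  assume "d \<in> steps i j"
  from steps_diff[OF ij this mult[of "d div ?p"]] have "d mod ?p \<in> steps i j"
    by (simp add: minus_mult_div_eq_mod)
  moreover have "0 \<le> d mod ?p" "d mod ?p < ?p" using modulus_pos(1)[OF ij] by auto
  ultimately have "\<not> d mod ?p > 0"
    using not_less_Least[of "nat (d mod ?p)" "\<lambda>p. p > 0 \<and> int p \<in> steps i j"]
    unfolding modulus_def[symmetric] by auto
  with \<open>0 \<le> d mod ?p\<close> show "?p dvd d" by (simp add: mod_eq_0_iff_dvd)
qed

lemma modulus_dvd: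
  assumes "i \<in> {1..4}" "j \<in> {1..4}"
  shows "modulus i j dvd a i" "modulus i j dvd a j"
  using steps_exponents[OF assms] steps_iff[OF assms] by auto

text \<open>Translation by y times the generator exchanges (x, y) and (x - y, 0), so only x - y
  matters.\<close>

lemma image_pair:
  assumes ij: "i \<in> {1..4}" "j \<in> {1..4}" and xy: "x < a i" "y < a j"
  shows "(\<exists>g\<in>G. g i = of_nat x / of_nat (a i) \<and> g j = of_nat y / of_nat (a j)) \<longleftrightarrow>
    x mod modulus i j = y mod modulus i j" (is "?L \<longleftrightarrow> _")
proof -
  have "?L \<longleftrightarrow> int x - int y \<in> steps i j"
  proof
    assume ?L
    then obtain g where g: "g \<in> G" "g i = of_nat x / of_nat (a i)" "g j = of_nat y / of_nat (a j)"
      by auto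
    have "frac (of_nat x / u + frac (- frac (of_nat y / u))) = frac ((of_nat x - of_nat y) / u)"
      for u :: rat
      by (simp add: frac_neg_frac diff_divide_distrib)
    then show "int x - int y \<in> steps i j"
      unfolding steps_def mem_Collect_eq using g ij
      by (intro bexI[OF _ add_in[OF g(1) neg_in[OF multiple_in[of y]]]])
        (simp add: frac_neg_frac)
  next
    assume "int x - int y \<in> steps i j"
    then obtain g where g: "g \<in> G" "g i = frac ((of_nat x - of_nat y) / of_nat (a i))" "g j = 0"
      by (auto simp: steps_def)
    have "frac (of_nat x / of_nat (a i)) = (of_nat x / of_nat (a i) :: rat)"
      "frac (of_nat y / of_nat (a j)) = (of_nat y / of_nat (a j) :: rat)"
      using xy by (simp_all add: frac_eq)
    moreover have "(of_nat x - of_nat y) / u + of_nat y / u = of_nat x / u" for u :: rat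
      by (simp flip: add_divide_distrib)
    ultimately show ?L
      using g ij by (intro bexI[OF _ add_in[OF g(1) multiple_in[of y]]]) simp
  qed
  also have "\<dots> \<longleftrightarrow> x mod modulus i j = y mod modulus i j"
    unfolding steps_iff[OF ij] by (metis mod_eq_dvd_iff of_nat_eq_iff zmod_int)
  finally show ?thesis .
qed

text \<open>\<open>G\<close> maps onto the fibre product, and by \<open>card_fibre\<close> every
  point has the same number of preimages.\<close>

lemma sum_pair:
  fixes f f' :: "rat \<Rightarrow> rat"
  assumes ij: "i \<in> {1..4}" "j \<in> {1..4}"
  shows "(\<Sum>g\<in>G. f (g i) * f' (g j)) = of_nat (card (stab {i, j})) *
    (\<Sum>(x, y)\<in>fibre_product (modulus i j) (a i) (a j).
      f (of_nat x / of_nat (a i)) * f' (of_nat y / of_nat (a j)))"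
proof -
  let ?M = "fibre_product (modulus i j) (a i) (a j)"
  let ?c = "\<lambda>(x, y). (of_nat x / of_nat (a i), of_nat y / of_nat (a j)) :: rat \<times> rat"
  let ?n = "of_nat (card (stab {i, j})) :: rat"
  have "(\<lambda>g. (g i, g j)) ` G \<subseteq> ?c ` ?M"
  proof
    fix z assume "z \<in> (\<lambda>g. (g i, g j)) ` G"
    then obtain g where g: "g \<in> G" "z = (g i, g j)" by auto
    obtain x where x: "x < a i" "g i = of_nat x / of_nat (a i)" using G_nth[OF g(1) ij(1)] .
    obtain y where y: "y < a j" "g j = of_nat y / of_nat (a j)" using G_nth[OF g(1) ij(2)] .
    have "(x, y) \<in> ?M"
      using image_pair[OF ij x(1) y(1)] g x y by (auto simp: fibre_product_def)
    then show "z \<in> ?c ` ?M" using g x y by force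
  qed
  then have "(\<Sum>g\<in>G. f (g i) * f' (g j)) =
      (\<Sum>z\<in>?c ` ?M. \<Sum>g | g \<in> G \<and> (g i, g j) = z. f (g i) * f' (g j))"
    by (intro sum.group[symmetric] finite_G finite_imageI finite_fibre_product)
  also have "\<dots> = (\<Sum>z\<in>?c ` ?M. ?n * (f (fst z) * f' (snd z)))"
  proof (intro sum.cong refl)
    fix z assume "z \<in> ?c ` ?M"
    then obtain x y where xy: "(x, y) \<in> ?M" "z = ?c (x, y)" by auto
    then obtain h where h: "h \<in> G" "z = (h i, h j)"
      using image_pair[OF ij, of x y] by (auto simp: fibre_product_def)
    have "{g \<in> G. (g i, g j) = z} = {g \<in> G. \<forall>k\<in>{i, j}. g k = h k}"
      using h by auto
    then have "card {g \<in> G. (g i, g j) = z} = card (stab {i, j})"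
      using card_fibre[OF h(1), of "{i, j}"] ij by simp
    moreover have "(\<Sum>g | g \<in> G \<and> (g i, g j) = z. f (g i) * f' (g j)) =
        (\<Sum>g | g \<in> G \<and> (g i, g j) = z. f (fst z) * f' (snd z))"
      by (intro sum.cong) auto
    ultimately show "(\<Sum>g | g \<in> G \<and> (g i, g j) = z. f (g i) * f' (g j)) = ?n * (f (fst z) * f' (snd z))"
      by simp
  qed
  also have "\<dots> = (\<Sum>z\<in>?M. ?n * (f (fst (?c z)) * f' (snd (?c z))))"
    using pos[OF ij(1)] pos[OF ij(2)] by (subst sum.reindex) (auto simp: inj_on_def)
  finally show ?thesis by (simp add: sum_distrib_left case_prod_unfold)
qed

lemma modulus_card:
  assumes ij: "i \<in> {1..4}" "j \<in> {1..4}"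
  shows "modulus i j * card G = a i * a j * card (stab {i, j})"
proof -
  have "(of_nat (card G) :: rat) =
      of_nat (card (stab {i, j}) * card (fibre_product (modulus i j) (a i) (a j)))"
    using sum_pair[OF ij, of "\<lambda>_. 1" "\<lambda>_. 1"] by simp
  then have "card G = card (stab {i, j}) * card (fibre_product (modulus i j) (a i) (a j))"
    by (simp only: of_nat_eq_iff)
  then show ?thesis
    using card_fibre_product[OF modulus_pos(1)[OF ij] modulus_dvd[OF ij]] by (simp add: ac_simps)
qed

lemma sum_sawtooth_pair:
  assumes ij: "i \<in> {1..4}" "j \<in> {1..4}"
  shows "(\<Sum>g\<in>G. sawtooth (g i) * sawtooth (g j)) =
    of_nat (card (stab {i, j})) * ((of_nat (modulus i j) - 1) * (of_nat (modulus i j) - 2)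
      / (12 * of_nat (modulus i j)))"
  unfolding sum_pair[OF ij]
    sum_sawtooth_fibre_product[OF modulus_pos(1)[OF ij] modulus_dvd[OF ij] pos[OF ij(1)] pos[OF ij(2)]] ..

lemma sum_sawtooth_single:
  assumes i: "i \<in> {1..4}"
  shows "(\<Sum>g\<in>G. (sawtooth (g i))\<^sup>2) =
    of_nat (card G) * ((of_nat (a i) - 1) * (of_nat (a i) - 2) / (12 * (of_nat (a i))\<^sup>2))"
  unfolding sum_coordinate[OF i, of "\<lambda>x. (sawtooth x)\<^sup>2"] sum_sawtooth_sq[OF pos[OF i]]
    card_stab_single[OF i]
  by (simp add: power2_eq_square)

text \<open>Use (p-1)(p-2)/p = p - 3 + 2/p together with n/p = |G|/(a_i a_j) from
  \<open>modulus_card\<close>. This isolates the product n p.\<close>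

lemma sum_sawtooth_pair':
  assumes ij: "i \<in> {1..4}" "j \<in> {1..4}"
  shows "12 * (\<Sum>g\<in>G. sawtooth (g i) * sawtooth (g j)) =
    of_nat (card (stab {i, j}) * modulus i j) - 3 * of_nat (card (stab {i, j}))
      + 2 * of_nat (card G) * (1 / of_nat (a i)) * (1 / of_nat (a j))"
proof -
  let ?n = "of_nat (card (stab {i, j})) :: rat" and ?p = "of_nat (modulus i j) :: rat"
  have "?p * of_nat (card G) = of_nat (a i) * of_nat (a j) * ?n"
    using arg_cong[OF modulus_card[OF ij], of of_nat] by (simp only: of_nat_mult)
  moreover have p: "?p > 0" using modulus_pos(1)[OF ij] by simp
  ultimately have "?n / ?p = of_nat (card G) * (1 / of_nat (a i)) * (1 / of_nat (a j))"
    using pos[OF ij(1)] pos[OF ij(2)] by (simp add: field_simps)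
  moreover have "12 * (?n * ((?p - 1) * (?p - 2) / (12 * ?p))) = ?n * ?p - 3 * ?n + 2 * (?n / ?p)"
    using p by (simp add: field_simps)
  ultimately show ?thesis
    unfolding sum_sawtooth_pair[OF ij] by (simp add: mult.assoc)
qed

section \<open>Levels, zero coordinates and the sum of the n_ij p_ij\<close>

lemma sum_of_bool: "(\<Sum>g\<in>G. of_bool (\<forall>i\<in>J. g i = 0)) = (of_nat (card (stab J)) :: rat)"
  using finite_G by (simp add: stab_def sum.If_cases Int_def)

lemma sum_of_bool_eq: "h \<in> G \<Longrightarrow> (\<Sum>g\<in>G. of_bool (g = h)) = (1 :: rat)"
  using finite_G by (simp add: of_bool_def)

lemma stab_all: "stab {1..4} = {\<lambda>i\<in>{1..4}. 0}"
proof -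
  have "g = (\<lambda>i\<in>{1..4}. 0)" if "g \<in> stab {1..4}" for g
    using that zero_in by (intro G_eqI) (auto simp: stab_def)
  then show ?thesis using zero_in by (auto simp: stab_def)
qed

text \<open>A nonzero coordinate is at least 1/a_i, and these lower bounds already add up to
  1.\<close>

lemma full_level_1:
  assumes g: "g \<in> G" "\<And>i. i \<in> {1..4} \<Longrightarrow> g i \<noteq> 0" "(\<Sum>i=1..4. g i) = 1"
  shows "g = (\<lambda>i\<in>{1..4}. 1 / of_nat (a i))"
proof (rule G_eqI[OF g(1) generator_in])
  have "1 / of_nat (a i) \<le> g i" if i: "i \<in> {1..4}" for i
  proof -
    obtain k where k: "k < a i" "g i = of_nat k / of_nat (a i)" using G_nth[OF g(1) i] .
    then have "1 \<le> k" using g(2)[OF i] by (cases k) auto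
    then show ?thesis using k by (simp add: divide_right_mono)
  qed
  then show "g i = (\<lambda>i\<in>{1..4}. 1 / of_nat (a i)) i" if "i \<in> {1..4}" for i
    using sum_mono_inv[of "\<lambda>i. 1 / of_nat (a i)" "{1..4}" g i] that g(3) recip by simp
qed

lemma neg_generator: "(\<lambda>i\<in>{1..4}. 1 - 1 / of_nat (a i)) \<in> G"
proof -
  have *: "frac (- (1 / of_nat (a i))) = (1 - 1 / of_nat (a i) :: rat)" if "i \<in> {1..4}" for i
    using two_le[OF that] by (auto simp: frac_unique_iff)
  have "(\<lambda>i\<in>{1..4}. frac (- (\<lambda>i\<in>{1..4}. 1 / of_nat (a i) :: rat) i)) =
      (\<lambda>i\<in>{1..4}. 1 - 1 / of_nat (a i))"
    by (intro restrict_ext) (simp add: *)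
  then show ?thesis using neg_in[OF generator_in] by (simp only:)
qed

text \<open>Dually, each coordinate is at most 1 - 1/a_i, and these upper bounds add up to
  3.\<close>

lemma level_3:
  assumes g: "g \<in> G" "(\<Sum>i=1..4. g i) = 3"
  shows "g = (\<lambda>i\<in>{1..4}. 1 - 1 / of_nat (a i))"
proof (rule G_eqI[OF g(1) neg_generator])
  have "g i \<le> 1 - 1 / of_nat (a i)" if i: "i \<in> {1..4}" for i
  proof -
    obtain k where k: "k < a i" "g i = of_nat k / of_nat (a i)" using G_nth[OF g(1) i] .
    then have "of_nat (k + 1) \<le> (of_nat (a i) :: rat)" by (intro of_nat_mono) simp
    then show ?thesis using k pos[OF i] by (simp add: field_simps)
  qed
  moreover have "(\<Sum>i=1..4. 1 - 1 / of_nat (a i) :: rat) = 3"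
    using recip by (simp add: sum_subtractf)
  ultimately show "g i = (\<lambda>i\<in>{1..4}. 1 - 1 / of_nat (a i)) i" if "i \<in> {1..4}" for i
    using sum_mono_inv[of g "{1..4}" "\<lambda>i. 1 - 1 / of_nat (a i)" i] that g(2) by simp
qed

lemma full_level_1_iff:
  assumes g: "g \<in> G"
  shows "(\<forall>i\<in>{1..4}. g i \<noteq> 0) \<and> (\<Sum>i=1..4. g i) = 1 \<longleftrightarrow> g = (\<lambda>i\<in>{1..4}. 1 / of_nat (a i))"
  using full_level_1[OF g] recip pos by fastforce

lemma level_3_iff:
  assumes g: "g \<in> G"
  shows "(\<Sum>i=1..4. g i) = 3 \<longleftrightarrow> g = (\<lambda>i\<in>{1..4}. 1 - 1 / of_nat (a i))"
proof -
  have "(\<Sum>i=1..4. 1 - 1 / of_nat (a i) :: rat) = 3"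
    using recip by (simp add: sum_subtractf)
  then show ?thesis using level_3[OF g] by auto
qed

lemma sum_cases:
  assumes "g \<in> G"
  shows "g 1 + g 2 + g 3 + g 4 \<in> {0, 1, 2, 3}"
proof -
  obtain m where m: "g 1 + g 2 + g 3 + g 4 = of_int m"
    using G_sum[OF assms] unfolding sum_1_4 by (auto elim: Ints_cases)
  have "0 \<le> g 1" "g 1 < 1" "0 \<le> g 2" "g 2 < 1" "0 \<le> g 3" "g 3 < 1" "0 \<le> g 4" "g 4 < 1"
    using G_bounds[OF assms] by auto
  then have "of_int 0 \<le> (of_int m :: rat)" "(of_int m :: rat) < of_int 4"
    using m by auto
  then have "0 \<le> m" "m < 4" by (simp_all only: of_int_le_iff of_int_less_iff)
  then have "m \<in> {0, 1, 2, 3}" by auto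
  then show ?thesis using m by auto
qed

text \<open>The remaining coordinate would be an integer in [0,1).\<close>

lemma three_zeros:
  assumes "g \<in> G"
  shows "g 1 = 0 \<Longrightarrow> g 2 = 0 \<Longrightarrow> g 3 = 0 \<Longrightarrow> g 4 = 0"
    "g 1 = 0 \<Longrightarrow> g 2 = 0 \<Longrightarrow> g 4 = 0 \<Longrightarrow> g 3 = 0"
    "g 1 = 0 \<Longrightarrow> g 3 = 0 \<Longrightarrow> g 4 = 0 \<Longrightarrow> g 2 = 0"
    "g 2 = 0 \<Longrightarrow> g 3 = 0 \<Longrightarrow> g 4 = 0 \<Longrightarrow> g 1 = 0"
  using sum_cases[OF assms] G_bounds(2)[OF assms, of 1] G_bounds(2)[OF assms, of 2]
    G_bounds(2)[OF assms, of 3] G_bounds(2)[OF assms, of 4]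
  by auto

text \<open>
  In \<open>\<Sum>\<^sub>g (\<Sum>\<^sub>i ((g\<^sub>i)))\<^sup>2\<close>, on the one hand the inner sum is
  the level minus half the size of the support, so it is \<open>\<plusminus>1\<close> at the generator of \<open>G\<^sub>0\<close> and its
  inverse, \<open>\<plusminus>1/2\<close> at the elements with one zero coordinate, and \<open>0\<close> elsewhere.  On the other
  hand the cross terms are Dedekind sums of the fibre products, known in closed form.
\<close>

theorem sum_stab_modulus:
  "(\<Sum>(i, j)\<in>coord_pairs. card (stab {i, j}) * modulus i j) = 24"
proof -
  let ?N = "of_nat (card G) :: rat"
  let ?A = "\<lambda>i. 1 / of_nat (a i) :: rat"
  let ?n = "\<lambda>i j. of_nat (card (stab {i, j})) :: rat"
  let ?np = "\<lambda>i j. of_nat (card (stab {i, j}) * modulus i j) :: rat"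
  let ?B = "\<Sum>g\<in>G. (\<Sum>i=1..4. sawtooth (g i))\<^sup>2"
  let ?S = "\<lambda>i j. \<Sum>g\<in>G. sawtooth (g i) * sawtooth (g j)"
  have A: "?A 1 + ?A 2 + ?A 3 + ?A 4 = 1" using recip by (simp only: sum_1_4)
  have "4 * ?B = (\<Sum>g\<in>G. 4 * (\<Sum>i=1..4. sawtooth (g i))\<^sup>2)"
    by (simp only: sum_distrib_left)
  also have "\<dots> = (\<Sum>g\<in>G. 4 * of_bool (g = (\<lambda>i\<in>{1..4}. 1 / of_nat (a i)))
      + 4 * of_bool (g = (\<lambda>i\<in>{1..4}. 1 - 1 / of_nat (a i)))
      + (\<Sum>i=1..4. of_bool (\<forall>k\<in>{i}. g k = 0))
      - 2 * (\<Sum>(i, j)\<in>coord_pairs. of_bool (\<forall>k\<in>{i, j}. g k = 0))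
      + 8 * of_bool (\<forall>k\<in>{1..4}. g k = 0))"
  proof (intro sum.cong refl)
    fix g assume g: "g \<in> G"
    have b: "0 \<le> g 1" "g 1 < 1" "0 \<le> g 2" "g 2 < 1" "0 \<le> g 3" "g 3 < 1" "0 \<le> g 4" "g 4 < 1"
      using G_bounds[OF g] by auto
    show "4 * (\<Sum>i=1..4. sawtooth (g i))\<^sup>2 = 4 * of_bool (g = (\<lambda>i\<in>{1..4}. 1 / of_nat (a i)))
      + 4 * of_bool (g = (\<lambda>i\<in>{1..4}. 1 - 1 / of_nat (a i)))
      + (\<Sum>i=1..4. of_bool (\<forall>k\<in>{i}. g k = 0))
      - 2 * (\<Sum>(i, j)\<in>coord_pairs. of_bool (\<forall>k\<in>{i, j}. g k = 0))
      + 8 * of_bool (\<forall>k\<in>{1..4}. g k = 0)"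
      using sawtooth_total_sq[OF b sum_cases[OF g]]
      unfolding full_level_1_iff[OF g, symmetric] level_3_iff[OF g, symmetric] ball_1_4
      by (simp only: sum_1_4 sum_coord_pairs ball_simps conj_assoc simp_thms)
  qed
  \<comment> \<open>The first 8 comes from the generator and its inverse, the last from the zero
    vector.\<close>
  also have "\<dots> = 8 + (\<Sum>i=1..4. of_nat (card (stab {i})))
      - 2 * (\<Sum>(i, j)\<in>coord_pairs. ?n i j) + 8"
    by (simp only: sum.distrib sum_subtractf sum_1_4 sum_coord_pairs sum_of_bool sum_of_bool_eq
      generator_in neg_generator stab_all sum_distrib_left[symmetric]) simp
  finally have B1: "4 * ?B = 16 + (\<Sum>i=1..4. of_nat (card (stab {i})))
      - 2 * (\<Sum>(i, j)\<in>coord_pairs. ?n i j)"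
    by simp
  have single: "12 * ?S i i = ?N * (1 - 3 * ?A i + 2 * (?A i * ?A i))" if i: "i \<in> {1..4}" for i
    using sum_sawtooth_single[OF i] pos[OF i] by (simp add: power2_eq_square field_simps)
  have "?B = ?S 1 1 + ?S 2 2 + ?S 3 3 + ?S 4 4
      + 2 * (?S 1 2 + ?S 1 3 + ?S 1 4 + ?S 2 3 + ?S 2 4 + ?S 3 4)"
    unfolding sum_1_4 sum_distrib_left sum.distrib[symmetric]
    by (intro sum.cong refl) (simp add: power2_eq_square algebra_simps)
  then have "12 * ?B = 12 * ?S 1 1 + 12 * ?S 2 2 + 12 * ?S 3 3 + 12 * ?S 4 4
      + 2 * (12 * ?S 1 2 + 12 * ?S 1 3 + 12 * ?S 1 4 + 12 * ?S 2 3 + 12 * ?S 2 4 + 12 * ?S 3 4)"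
    by (simp only: distrib_left mult.left_commute)
  \<comment> \<open>The mixed terms of the pair sums complete the squares of the 1/a_i to the square
    of their sum, which is 1; the coefficient of |G| becomes 4 - 3 + 2 = 3.\<close>
  also have "\<dots> = ?N * (4 - 3 * (?A 1 + ?A 2 + ?A 3 + ?A 4) + 2 * (?A 1 + ?A 2 + ?A 3 + ?A 4)\<^sup>2)
     + 2 * (\<Sum>(i, j)\<in>coord_pairs. ?np i j) - 6 * (\<Sum>(i, j)\<in>coord_pairs. ?n i j)"
  proof -
    have I: "1 \<in> {1..4::nat}" "2 \<in> {1..4::nat}" "3 \<in> {1..4::nat}" "4 \<in> {1..4::nat}" by auto
    show ?thesis
      unfolding sum_coord_pairs I[THEN single] sum_sawtooth_pair'[OF I(1,2)]
        sum_sawtooth_pair'[OF I(1,3)] sum_sawtooth_pair'[OF I(1,4)] sum_sawtooth_pair'[OF I(2,3)]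
        sum_sawtooth_pair'[OF I(2,4)] sum_sawtooth_pair'[OF I(3,4)] power2_eq_square
      by algebra
  qed
  finally have B2: "12 * ?B = 3 * ?N + 2 * (\<Sum>(i, j)\<in>coord_pairs. ?np i j)
      - 6 * (\<Sum>(i, j)\<in>coord_pairs. ?n i j)"
    unfolding A by simp
  \<comment> \<open>Three times \<open>B1\<close> against \<open>B2\<close>: the terms in |G| and
    n_ij agree, leaving 48 = 2 * sum of n_ij p_ij.\<close>
  have "(\<Sum>(i, j)\<in>coord_pairs. ?np i j) = of_nat 24"
    using B1 B2 sum_card_stab_single by simp
  then show ?thesis
    unfolding case_prod_unfold of_nat_sum[symmetric] of_nat_eq_iff .
qed

section \<open>The Vafa formula\<close>

theorem vafa_euler_eq: "vafa_euler a G = 24"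
proof -
  let ?N = "of_nat (card G) :: rat"
  let ?a = "\<lambda>i. of_nat (a i) :: rat"
  let ?z = "\<lambda>J (g, h). of_bool (\<forall>i\<in>J. g i = 0 \<and> h i = 0) :: rat"
  let ?n = "\<lambda>J. of_nat (card (stab J)) :: rat"
  have a0: "?a 1 \<noteq> 0" "?a 2 \<noteq> 0" "?a 3 \<noteq> 0" "?a 4 \<noteq> 0"
    using pos[of 1] pos[of 2] pos[of 3] pos[of 4] by auto
  have N0: "?N \<noteq> 0" using finite_G zero_in by auto
  \<comment> \<open>The reciprocal condition without denominators. It cancels the cubic against the
    quartic terms when all four coordinates are common zeros.\<close>
  have recip': "?a 1 * ?a 2 * ?a 3 * ?a 4 =
      ?a 2 * ?a 3 * ?a 4 + ?a 1 * ?a 3 * ?a 4 + ?a 1 * ?a 2 * ?a 4 + ?a 1 * ?a 2 * ?a 3"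
    using recip[unfolded sum_1_4] a0 by (simp add: field_simps)
  \<comment> \<open>A pair vanishes on \<open>J\<close> exactly when both of its entries lie in
    \<open>stab J\<close>.\<close>
  have sq: "(\<Sum>x\<in>G \<times> G. ?z J x) = (?n J)\<^sup>2" for J
  proof -
    have "(\<Sum>x\<in>G \<times> G. ?z J x) = of_nat (card (stab J \<times> stab J))"
      using finite_G by (subst card_eq_sum, unfold of_nat_sum, intro sum.mono_neutral_cong_right)
        (auto simp: stab_def)
    then show ?thesis by (simp add: card_cartesian_product power2_eq_square)
  qed
  have expand: "(\<Prod>i\<in>{i \<in> {1..4}. g i = 0 \<and> h i = 0}. 1 - ?a i) =
      1 - (\<Sum>i=1..4. ?a i * ?z {i} (g, h)) + (\<Sum>(i, j)\<in>coord_pairs. ?a i * ?a j * ?z {i, j} (g, h))"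
    if g: "g \<in> G" and h: "h \<in> G" for g h
  proof -
    have prod: "(\<Prod>i\<in>{i \<in> {1..4}. P i}. 1 - ?a i) =
        (if P 1 then 1 - ?a 1 else 1) * (if P 2 then 1 - ?a 2 else 1)
        * (if P 3 then 1 - ?a 3 else 1) * (if P 4 then 1 - ?a 4 else 1)" for P
      by (subst prod.inter_filter) (simp_all only: prod_1_4 finite_atLeastAtMost)
    define w where "w i = (g i = 0 \<and> h i = 0)" for i
    have w: "w 1 \<and> w 2 \<and> w 3 \<Longrightarrow> w 4" "w 1 \<and> w 2 \<and> w 4 \<Longrightarrow> w 3"
      "w 1 \<and> w 3 \<and> w 4 \<Longrightarrow> w 2" "w 2 \<and> w 3 \<and> w 4 \<Longrightarrow> w 1"
      using three_zeros[OF g] three_zeros[OF h] by (simp_all add: w_def)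
    have z: "?z J (g, h) = of_bool (\<forall>i\<in>J. w i)" for J
      by (simp add: w_def)
    show ?thesis
      unfolding z prod sum_1_4 sum_coord_pairs w_def[symmetric]
      using w recip'
      by (cases "w 1"; cases "w 2"; cases "w 3"; cases "w 4") (simp_all add: algebra_simps)
  qed
  have "(\<Sum>(g, h)\<in>G \<times> G. \<Prod>i\<in>{i \<in> {1..4}. g i = 0 \<and> h i = 0}. 1 - ?a i) =
      (\<Sum>x\<in>G \<times> G. ?z {} x - (\<Sum>i=1..4. ?a i * ?z {i} x)
        + (\<Sum>(i, j)\<in>coord_pairs. ?a i * ?a j * ?z {i, j} x))"
    by (intro sum.cong refl) (use expand in auto)
  also have "\<dots> = ?N\<^sup>2 - (\<Sum>i=1..4. ?a i * (?n {i})\<^sup>2)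
      + (\<Sum>(i, j)\<in>coord_pairs. ?a i * ?a j * (?n {i, j})\<^sup>2)"
    by (simp only: sum.distrib sum_subtractf sum_1_4 sum_coord_pairs sq stab_empty
      sum_distrib_left[symmetric])
  \<comment> \<open>By equidistribution the singleton terms are |G|^2/a_i; their sum cancels the
    term of the empty set.\<close>
  also have "(\<Sum>i=1..4. ?a i * (?n {i})\<^sup>2) = (\<Sum>i=1..4. ?N\<^sup>2 * (1 / ?a i))"
    by (intro sum.cong refl) (use pos in \<open>simp add: card_stab_single power2_eq_square\<close>)
  also have "\<dots> = ?N\<^sup>2"
    using recip by (simp only: mult_1_right flip: sum_distrib_left)
  \<comment> \<open>One factor n_ij is absorbed by a_i a_j n_ij = p_ij |G|.\<close>
  also have "(\<Sum>(i, j)\<in>coord_pairs. ?a i * ?a j * (?n {i, j})\<^sup>2) =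
      (\<Sum>(i, j)\<in>coord_pairs. ?N * of_nat (card (stab {i, j}) * modulus i j))"
  proof (intro sum.cong refl, clarify)
    fix i j assume "(i, j) \<in> coord_pairs"
    then have "of_nat (modulus i j * card G) = (of_nat (a i * a j * card (stab {i, j})) :: rat)"
      using modulus_card coord_pairsD by metis
    then show "?a i * ?a j * (?n {i, j})\<^sup>2 = ?N * of_nat (card (stab {i, j}) * modulus i j)"
      by (simp add: power2_eq_square algebra_simps)
  qed
  also have "\<dots> = ?N * of_nat (\<Sum>(i, j)\<in>coord_pairs. card (stab {i, j}) * modulus i j)"
    unfolding case_prod_unfold of_nat_sum sum_distrib_left ..
  also have "\<dots> = ?N * 24" by (simp add: sum_stab_modulus)
  finally show ?thesis using N0 by (simp add: vafa_euler_def)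
qed

section \<open>Elements without zero coordinates and invariant deformations\<close>

text \<open>Inclusion-exclusion over pairs suffices: three zeros do not occur, and at the zero
  vector 1 - 4 + 6 = 3 is subtracted separately. In the sum over \<open>G\<close> the singleton
  terms cancel |G|.\<close>

lemma card_full_support:
  "card {g \<in> G. \<forall>i\<in>{1..4}. g i \<noteq> 0} + 3 = (\<Sum>(i, j)\<in>coord_pairs. card (stab {i, j}))"
proof -
  have "of_nat (card {g \<in> G. \<forall>i\<in>{1..4}. g i \<noteq> 0}) =
      (\<Sum>g\<in>G. of_bool (\<forall>i\<in>{1..4}. g i \<noteq> 0) :: rat)"
    using finite_G by (simp add: Int_def)
  also have "\<dots> = (\<Sum>g\<in>G. of_bool (\<forall>k\<in>{}. g k = 0) - (\<Sum>i=1..4. of_bool (\<forall>k\<in>{i}. g k = 0))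
      + (\<Sum>(i, j)\<in>coord_pairs. of_bool (\<forall>k\<in>{i, j}. g k = 0))
      - 3 * of_bool (\<forall>k\<in>{1..4}. g k = 0))"
  proof (intro sum.cong refl)
    fix g assume g: "g \<in> G"
    show "(of_bool (\<forall>i\<in>{1..4}. g i \<noteq> 0) :: rat) =
      of_bool (\<forall>k\<in>{}. g k = 0) - (\<Sum>i=1..4. of_bool (\<forall>k\<in>{i}. g k = 0))
      + (\<Sum>(i, j)\<in>coord_pairs. of_bool (\<forall>k\<in>{i, j}. g k = 0))
      - 3 * of_bool (\<forall>k\<in>{1..4}. g k = 0)"
      unfolding sum_1_4 sum_coord_pairs ball_1_4
      using sum_cases[OF g] G_bounds(1,2)[OF g, of 1] G_bounds(1,2)[OF g, of 2]
        G_bounds(1,2)[OF g, of 3] G_bounds(1,2)[OF g, of 4]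
      by (cases "g 1 = 0"; cases "g 2 = 0"; cases "g 3 = 0"; cases "g 4 = 0") auto
  qed
  also have "\<dots> = of_nat (card G) - (\<Sum>i=1..4. of_nat (card (stab {i})))
      + (\<Sum>(i, j)\<in>coord_pairs. of_nat (card (stab {i, j}))) - 3"
    by (simp only: sum.distrib sum_subtractf sum_1_4 sum_coord_pairs sum_of_bool stab_empty stab_all
      sum_distrib_left[symmetric]) simp
  finally have "of_nat (card {g \<in> G. \<forall>i\<in>{1..4}. g i \<noteq> 0} + 3) =
      (of_nat (\<Sum>(i, j)\<in>coord_pairs. card (stab {i, j})) :: rat)"
    unfolding sum_card_stab_single by (simp add: case_prod_unfold)
  then show ?thesis by (simp only: of_nat_eq_iff)
qed

text \<open>Without zero coordinates level 0 is impossible, and levels 1 and 3 contain only the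
  generator and its inverse. Removing these two turns 3 into 5.\<close>

lemma card_level_2:
  "card {g \<in> G. (\<forall>i\<in>{1..4}. g i \<noteq> 0) \<and> (\<Sum>i=1..4. g i) = 2} + 5 =
    (\<Sum>(i, j)\<in>coord_pairs. card (stab {i, j}))"
proof -
  let ?F = "\<lambda>g. \<forall>i\<in>{1..4}. g i \<noteq> (0::rat)"
  let ?e = "\<lambda>i\<in>{1..4}. 1 / of_nat (a i) :: rat" and ?e' = "\<lambda>i\<in>{1..4}. 1 - 1 / of_nat (a i) :: rat"
  let ?L = "{g \<in> G. ?F g \<and> (\<Sum>i=1..4. g i) = 2}"
  have "?F g" if g: "g \<in> G" "(\<Sum>i=1..4. g i) = 3" for g
    using g two_le by (fastforce dest: level_3)
  moreover have "(\<Sum>i=1..4. g i) \<noteq> 0" if "g \<in> G" "?F g" for g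
    using that G_bounds[OF that(1)] sum_nonneg_eq_0_iff[of "{1..4}" g] by auto
  moreover have "(\<Sum>i=1..4. g i) \<in> {0, 1, 2, 3}" if "g \<in> G" for g
    using sum_cases[OF that] unfolding sum_1_4 .
  ultimately have "{g \<in> G. ?F g} = {g \<in> G. (\<Sum>i=1..4. g i) = 3}
      \<union> ({g \<in> G. ?F g \<and> (\<Sum>i=1..4. g i) = 1} \<union> ?L)"
    by blast
  also have "{g \<in> G. (\<Sum>i=1..4. g i) = 3} = {?e'}"
    using level_3_iff neg_generator by blast
  also have "{g \<in> G. ?F g \<and> (\<Sum>i=1..4. g i) = 1} = {?e}"
    using full_level_1_iff generator_in by blast
  finally have F: "{g \<in> G. ?F g} = insert ?e' (insert ?e ?L)"
    by (simp only: Un_insert_left Un_empty_left)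
  have e: "sum ?e {1..4} = 1" and e': "sum ?e' {1..4} = 3"
    using full_level_1_iff[OF generator_in] level_3_iff[OF neg_generator] by blast+
  then have "?e' \<notin> insert ?e ?L" "?e \<notin> ?L" by (auto simp del: restrict_apply)
  then have "card {g \<in> G. ?F g} = card ?L + 2"
    unfolding F using finite_G by simp
  then show ?thesis using card_full_support by simp
qed

text \<open>Adding the generator sends s_i to s_i + 1 and level 1 to level 2. The range 0 to a_i - 2
  becomes 1 to a_i - 1: no coordinate wraps around and none vanishes.\<close>

lemma card_deformations:
  "card (deformations a G) + 5 = (\<Sum>(i, j)\<in>coord_pairs. card (stab {i, j}))"
proof -
  let ?L = "{g \<in> G. (\<forall>i\<in>{1..4}. g i \<noteq> 0) \<and> (\<Sum>i=1..4. g i) = 2}"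
  let ?f = "\<lambda>s. \<lambda>i\<in>{1..4}. of_int (s i + 1) / of_nat (a i) :: rat"
  have "inj_on ?f (deformations a G)"
  proof (rule inj_onI)
    fix s t assume s: "s \<in> deformations a G" and t: "t \<in> deformations a G" and eq: "?f s = ?f t"
    have "s i = t i" if i: "i \<in> {1..4}" for i
      using fun_cong[OF eq, of i] i pos[OF i] by simp
    then show "s = t"
      using s t by (auto simp: deformations_def intro: PiE_ext)
  qed
  moreover have "?f ` deformations a G = ?L"
  proof (intro equalityI subsetI)
    fix g assume "g \<in> ?f ` deformations a G"
    then obtain s where s: "s \<in> deformations a G" "g = ?f s" by auto
    have bd: "0 \<le> s i" "s i + 1 < int (a i)" if "i \<in> {1..4}" for i
      using s(1) that by (fastforce simp: deformations_def PiE_def Pi_def)+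
    have fr: "frac (of_int (s i) / of_nat (a i) + 1 / of_nat (a i)) = (of_int (s i + 1) / of_nat (a i) :: rat)"
      if i: "i \<in> {1..4}" for i
    proof -
      have "of_int (s i + 1) < (of_int (int (a i)) :: rat)" using bd[OF i] by (simp only: of_int_less_iff)
      then have "frac (of_int (s i + 1) / of_nat (a i)) = (of_int (s i + 1) / of_nat (a i) :: rat)"
        using bd[OF i] pos[OF i] by (simp add: frac_eq)
      then show ?thesis by (simp add: add_divide_distrib)
    qed
    have "g = (\<lambda>i\<in>{1..4}. frac ((\<lambda>i\<in>{1..4}. of_int (s i) / of_nat (a i) :: rat) i
        + (\<lambda>i\<in>{1..4}. 1 / of_nat (a i)) i))"
      unfolding s(2) by (intro restrict_ext) (simp add: fr)
    moreover have sG: "(\<lambda>i\<in>{1..4}. of_int (s i) / of_nat (a i)) \<in> G"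
      using s(1) by (simp only: deformations_def mem_Collect_eq)
    ultimately have "g \<in> G" using add_in[OF sG generator_in] by (simp only:)
    moreover have "(\<Sum>i=1..4. g i) = (\<Sum>i=1..4. of_int (s i) / of_nat (a i) + 1 / of_nat (a i))"
      unfolding s(2) by (intro sum.cong refl) (simp add: add_divide_distrib)
    then have "(\<Sum>i=1..4. g i) = 2"
      using s(1) recip unfolding sum.distrib deformations_def by simp
    moreover have "g i \<noteq> 0" if "i \<in> {1..4}" for i
      using bd[OF that] pos[OF that] that by (simp add: s(2) flip: of_int_add[of _ 1, simplified])
    ultimately show "g \<in> ?L" by blast
  next
    fix g assume "g \<in> ?L"
    then have g: "g \<in> G" "\<And>i. i \<in> {1..4} \<Longrightarrow> g i \<noteq> 0" "(\<Sum>i=1..4. g i) = 2" by auto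
    have "\<exists>k. k \<ge> 1 \<and> k < int (a i) \<and> g i = of_int k / of_nat (a i)" if i: "i \<in> {1..4}" for i
    proof -
      obtain k where k: "k < a i" "g i = of_nat k / of_nat (a i)" using G_nth[OF g(1) i] .
      then have "1 \<le> k" using g(2)[OF i] by (cases k) auto
      then show ?thesis using k by (intro exI[of _ "int k"]) auto
    qed
    then obtain k where k: "\<And>i. i \<in> {1..4} \<Longrightarrow> k i \<ge> 1 \<and> k i < int (a i) \<and> g i = of_int (k i) / of_nat (a i)"
      by metis
    define s where "s = (\<lambda>i\<in>{1..4}. k i - 1)"
    have gs: "g = ?f s"
    proof (rule extensionalityI)
      show "g \<in> extensional {1..4}" using G_carrier[OF g(1)] unfolding Gmax_def PiE_def by simp
    qed (use k in \<open>auto simp: s_def\<close>)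
    have val: "of_int (s i) / of_nat (a i) = g i - 1 / of_nat (a i)" if "i \<in> {1..4}" for i
      using that unfolding gs by (simp add: add_divide_distrib)
    have "frac (g i + frac (- (1 / of_nat (a i)))) = of_int (s i) / of_nat (a i)"
      if i: "i \<in> {1..4}" for i
    proof -
      have "0 \<le> of_int (s i) / (of_nat (a i) :: rat)" using k[OF i] i by (simp add: s_def)
      moreover have "of_int (s i) / of_nat (a i) < (1 :: rat)"
        unfolding val[OF i] by (rule le_less_trans[OF _ G_bounds(2)[OF g(1) i]]) simp
      ultimately show ?thesis by (simp add: val[OF i] frac_eq)
    qed
    then have "(\<lambda>i\<in>{1..4}. of_int (s i) / of_nat (a i)) = (\<lambda>i\<in>{1..4}. frac (g i
        + (\<lambda>i\<in>{1..4}. frac (- (\<lambda>i\<in>{1..4}. 1 / of_nat (a i)) i)) i))"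
      by (intro restrict_ext) simp
    then have "(\<lambda>i\<in>{1..4}. of_int (s i) / of_nat (a i)) \<in> G"
      using add_in[OF g(1) neg_in[OF generator_in]] by (simp only:)
    moreover have "(\<Sum>i=1..4. of_int (s i) / of_nat (a i) :: rat) = (\<Sum>i=1..4. g i - 1 / of_nat (a i))"
      by (intro sum.cong refl val)
    then have "(\<Sum>i=1..4. of_int (s i) / of_nat (a i) :: rat) = 1"
      using g(3) recip by (simp add: sum_subtractf)
    moreover have "s \<in> (\<Pi>\<^sub>E i\<in>{1..4}. {0..int (a i) - 2})"
      using k by (fastforce simp: s_def)
    ultimately have "s \<in> deformations a G"
      by (simp only: deformations_def mem_Collect_eq)
    then show "g \<in> ?f ` deformations a G" using gs by blast
  qed
  ultimately have "card (deformations a G) = card ?L" using card_image by fastforce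
  then show ?thesis using card_level_2 by simp
qed

section \<open>Elements with two zeros, the mirror dual and Roan pairs\<close>

text \<open>By \<open>three_zeros\<close> a nonzero element vanishing at i and j has no further
  zero. Its level lies strictly between 0 and 2, so level one is automatic.\<close>

lemma two_zeros_iff:
  assumes "(i, j) \<in> coord_pairs"
  shows "z \<in> two_zeros G \<and> {k \<in> {1..4}. z k = 0} = {i, j} \<longleftrightarrow> z \<in> stab {i, j} - {\<lambda>k\<in>{1..4}. 0}"
proof
  assume "z \<in> two_zeros G \<and> {k \<in> {1..4}. z k = 0} = {i, j}"
  then have z: "z \<in> G" "{k \<in> {1..4}. z k = 0} = {i, j}"
    unfolding two_zeros_def by blast+
  have "z \<noteq> (\<lambda>k\<in>{1..4}. 0)"
  proof
    assume "z = (\<lambda>k\<in>{1..4}. 0)"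
    then have "{k \<in> {1..4}. z k = 0} = {1..4}" by auto
    then have "card {i, j} = 4" unfolding z(2) by simp
    then show False using coord_pairsD[OF assms] by simp
  qed
  moreover have "i \<in> {k \<in> {1..4}. z k = 0}" "j \<in> {k \<in> {1..4}. z k = 0}"
    unfolding z(2) by simp_all
  ultimately show "z \<in> stab {i, j} - {\<lambda>k\<in>{1..4}. 0}"
    using z(1) by (simp add: stab_def)
next
  assume "z \<in> stab {i, j} - {\<lambda>k\<in>{1..4}. 0}"
  then have z: "z \<in> G" "z i = 0" "z j = 0" and nz: "z \<noteq> (\<lambda>k\<in>{1..4}. 0)"
    unfolding stab_def by blast+
  have "\<not> (\<forall>k\<in>{1..4}. z k = 0)"
    using G_eqI[OF z(1) zero_in] nz by auto
  then have nz: "\<not> (z 1 = 0 \<and> z 2 = 0 \<and> z 3 = 0 \<and> z 4 = 0)"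
    unfolding ball_1_4 .
  have nz3: "\<not> (z 1 = 0 \<and> z 2 = 0 \<and> z 3 = 0)" "\<not> (z 1 = 0 \<and> z 2 = 0 \<and> z 4 = 0)"
    "\<not> (z 1 = 0 \<and> z 3 = 0 \<and> z 4 = 0)" "\<not> (z 2 = 0 \<and> z 3 = 0 \<and> z 4 = 0)"
    using nz three_zeros[OF z(1)] by blast+
  have iff: "{k \<in> {1..4}. z k = 0} = {i, j} \<longleftrightarrow> (\<forall>k\<in>{1..4}. z k = 0 \<longleftrightarrow> k = i \<or> k = j)"
    using coord_pairsD[OF assms] by blast
  have Z: "{k \<in> {1..4}. z k = 0} = {i, j}"
    unfolding iff ball_1_4 using assms z(2,3) nz3
    by (auto simp: coord_pairs_def)
  have "z 1 + z 2 + z 3 + z 4 = 1"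
    using sum_cases[OF z(1)] assms z(2,3) nz3
      G_bounds(1,2)[OF z(1), of 1] G_bounds(1,2)[OF z(1), of 2]
      G_bounds(1,2)[OF z(1), of 3] G_bounds(1,2)[OF z(1), of 4]
    by (auto simp: coord_pairs_def)
  then have "(\<Sum>k=1..4. z k) = 1" unfolding sum_1_4 .
  then show "z \<in> two_zeros G \<and> {k \<in> {1..4}. z k = 0} = {i, j}"
    using Z z(1) coord_pairsD[OF assms] by (simp add: two_zeros_def has_level_def)
qed

text \<open>Since g_i a_i is an integer, reducing the other argument modulo 1 changes the pairing by
  an integer.\<close>

lemma pairing_frac:
  assumes "g \<in> G" "(\<Sum>i=1..4. g i * of_nat (a i) * f i) \<in> \<int>"
  shows "(\<Sum>i=1..4. g i * of_nat (a i) * frac (f i)) \<in> \<int>"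
proof -
  have "(\<Sum>i=1..4. g i * of_nat (a i) * of_int \<lfloor>f i\<rfloor>) \<in> \<int>"
    using G_bounds(3)[OF assms(1)] by (intro Ints_sum Ints_mult[OF _ Ints_of_int]) auto
  then have "(\<Sum>i=1..4. g i * of_nat (a i) * f i) - (\<Sum>i=1..4. g i * of_nat (a i) * of_int \<lfloor>f i\<rfloor>) \<in> \<int>"
    using assms(2) by (rule Ints_diff[rotated])
  then show ?thesis by (simp add: frac_def right_diff_distrib sum_subtractf)
qed

text \<open>The generator lies in the dual because pairing with it gives the coordinate sum, an
  integer by the determinant condition.\<close>

lemma fermat_symmetries_mirror_dual: "fermat_symmetries a (mirror_dual a G)"
proof (rule fermat_symmetries.intro)
  interpret group "Gmax a" by (rule group_Gmax)
  have gen: "(\<lambda>i\<in>{1..4}. 1 / of_nat (a i)) \<in> mirror_dual a G"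
  proof -
    have "(\<Sum>i=1..4. g i * of_nat (a i) * (\<lambda>i\<in>{1..4}. 1 / of_nat (a i)) i) = (\<Sum>i=1..4. g i)" for g :: "nat \<Rightarrow> rat"
      by (intro sum.cong refl) (use pos in simp)
    then show ?thesis
      unfolding mirror_dual_def using G_carrier[OF generator_in] G_sum by simp
  qed
  show sub: "subgroup (mirror_dual a G) (Gmax a)"
  proof (rule subgroupI)
    show "mirror_dual a G \<subseteq> carrier (Gmax a)" by (auto simp: mirror_dual_def)
    show "mirror_dual a G \<noteq> {}" using gen by blast
  next
    fix x assume x: "x \<in> mirror_dual a G"
    then have xc: "x \<in> carrier (Gmax a)" by (simp add: mirror_dual_def)
    have "(\<Sum>i=1..4. g i * of_nat (a i) * (inv\<^bsub>Gmax a\<^esub> x) i) \<in> \<int>" if g: "g \<in> G" for g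
    proof -
      have "(\<Sum>i=1..4. g i * of_nat (a i) * frac (- x i)) \<in> \<int>"
        using x g by (intro pairing_frac) (auto simp: mirror_dual_def sum_negf)
      then show ?thesis unfolding carrier_inv[OF xc] by simp
    qed
    then show "inv\<^bsub>Gmax a\<^esub> x \<in> mirror_dual a G" using xc by (simp add: mirror_dual_def)
  next
    fix x y assume x: "x \<in> mirror_dual a G" and y: "y \<in> mirror_dual a G"
    then have "x \<otimes>\<^bsub>Gmax a\<^esub> y \<in> carrier (Gmax a)" by (simp add: mirror_dual_def)
    moreover have "(\<Sum>i=1..4. g i * of_nat (a i) * (x \<otimes>\<^bsub>Gmax a\<^esub> y) i) \<in> \<int>" if g: "g \<in> G" for g
    proof -
      have "(\<Sum>i=1..4. g i * of_nat (a i) * frac (x i + y i)) \<in> \<int>"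
        using x y g by (intro pairing_frac) (auto simp: mirror_dual_def distrib_left sum.distrib)
      then show ?thesis unfolding Gmax_simps by simp
    qed
    ultimately show "x \<otimes>\<^bsub>Gmax a\<^esub> y \<in> mirror_dual a G" by (simp add: mirror_dual_def)
  qed
  show "G0 a \<subseteq> mirror_dual a G"
    unfolding G0_def using gen sub by (intro generate_subgroup_incl) auto
qed (fact pos recip)+

lemma sum_two_coordinates:
  fixes f :: "nat \<Rightarrow> rat"
  assumes "i \<in> {1..4}" "j \<in> {1..4}" "i \<noteq> j" "\<And>k. k \<in> {1..4} - {i, j} \<Longrightarrow> f k = 0"
  shows "(\<Sum>k=1..4. f k) = f i + f j"
proof -
  have "(\<Sum>k=1..4. f k) = (\<Sum>k\<in>{i, j}. f k)"
    using assms by (intro sum.mono_neutral_right) auto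
  then show ?thesis using assms by simp
qed

text \<open>An integral sum forces z_j = -z_i modulo 1, so pairing with an element (x/a_i, y/a_j)
  gives (x - y) z_i modulo 1. As x - y ranges over multiples of p including p itself modulo a_i, the
  condition is that p z_i is integral; \<open>?f\<close> lists the p solutions.\<close>

lemma card_mirror_dual_stab:
  assumes ij: "i \<in> {1..4}" "j \<in> {1..4}" and neq: "i \<noteq> j"
  shows "card {z \<in> mirror_dual a G. \<forall>k\<in>{1..4} - {i, j}. z k = 0} = modulus i j" (is "card ?S = ?p")
proof -
  let ?f = "\<lambda>t::nat. \<lambda>k\<in>{1..4}. if k = i then of_nat t / of_nat ?p
    else if k = j then frac (- (of_nat t / of_nat ?p)) else (0::rat)"
  have p: "?p > 0" "?p dvd a i" "?p dvd a j"
    using modulus_pos[OF ij] modulus_dvd[OF ij] by auto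
  have grid: "\<exists>k<a m. of_nat t / of_nat ?p = (of_nat k / of_nat (a m) :: rat)"
    if m: "?p dvd a m" "a m > 0" and t: "t < ?p" for m t
  proof -
    obtain q where "a m = ?p * q" using m by (auto elim: dvdE)
    then show ?thesis using m t p by (intro exI[of _ "t * q"]) auto
  qed
  have neg: "\<exists>u<?p. frac (- (of_nat t / of_nat ?p)) = (of_nat u / of_nat ?p :: rat)" if "t < ?p" for t
  proof (cases "t = 0")
    case False
    have "frac (- (of_nat t / of_nat ?p)) = (of_nat (?p - t) / of_nat ?p :: rat)"
      unfolding frac_unique_iff using that False p by (auto simp: of_nat_diff field_simps)
    then show ?thesis using False that by (intro exI[of _ "?p - t"]) auto
  qed (use p in auto)
  have fS: "?f t \<in> ?S" if t: "t < ?p" for t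
  proof -
    have int: "of_nat t / of_nat ?p + frac (- (of_nat t / of_nat ?p :: rat)) \<in> \<int>"
      by (simp add: frac_def)
    have "?f t \<in> carrier (Gmax a)"
    proof (rule carrierI)
      fix k :: nat assume k: "k \<in> {1..4}"
      obtain u where "u < ?p" "frac (- (of_nat t / of_nat ?p)) = (of_nat u / of_nat ?p :: rat)"
        using neg[OF t] by auto
      then show "\<exists>m<a k. ?f t k = of_nat m / of_nat (a k)"
        using k grid[OF p(2) pos[OF ij(1)] t] grid[OF p(3) pos[OF ij(2)], of u] pos[OF k]
        by (auto intro: exI[of _ 0])
    next
      have "(\<Sum>k=1..4. ?f t k) = ?f t i + ?f t j"
        by (rule sum_two_coordinates[OF ij neq]) auto
      then show "(\<Sum>k=1..4. ?f t k) \<in> \<int>" using int ij neq by simp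
    qed auto
    moreover have "(\<Sum>k=1..4. g k * of_nat (a k) * ?f t k) \<in> \<int>" if g: "g \<in> G" for g
    proof -
      obtain x where x: "x < a i" "g i = of_nat x / of_nat (a i)" using G_nth[OF g ij(1)] .
      obtain y where y: "y < a j" "g j = of_nat y / of_nat (a j)" using G_nth[OF g ij(2)] .
      have "x mod ?p = y mod ?p"
        using image_pair[OF ij x(1) y(1)] g x y by auto
      then have "int ?p dvd int x - int y"
        by (metis mod_eq_dvd_iff zmod_int)
      then obtain q where q: "int x - int y = int ?p * q" by (auto elim: dvdE)
      have xy: "of_nat x = (of_nat y + of_nat ?p * of_int q :: rat)"
        using arg_cong[OF q, of "of_int :: int \<Rightarrow> rat"] by simp
      have "(\<Sum>k=1..4. g k * of_nat (a k) * ?f t k) =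
          g i * of_nat (a i) * ?f t i + g j * of_nat (a j) * ?f t j"
        by (rule sum_two_coordinates[OF ij neq]) auto
      also have "\<dots> = of_nat x * (of_nat t / of_nat ?p) + of_nat y * frac (- (of_nat t / of_nat ?p))"
        using x y ij neq pos[OF ij(1)] pos[OF ij(2)] by simp
      also have "\<dots> = of_nat t * of_int q
          + of_nat y * (of_nat t / of_nat ?p + frac (- (of_nat t / of_nat ?p)))"
        unfolding xy using p(1) by (simp add: field_simps)
      also have "\<dots> \<in> \<int>"
        by (rule Ints_add[OF Ints_mult[OF Ints_of_nat Ints_of_int] Ints_mult[OF Ints_of_nat int]])
      finally show ?thesis .
    qed
    ultimately show ?thesis by (auto simp: mirror_dual_def)
  qed
  have "inj_on ?f {..<?p}"
  proof (rule inj_onI)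
    fix t u assume "?f t = ?f u"
    from fun_cong[OF this, of i] show "t = u" using ij p(1) by simp
  qed
  moreover have "?f ` {..<?p} = ?S"
  proof (intro equalityI subsetI)
    fix z assume "z \<in> ?S"
    then have z: "z \<in> mirror_dual a G" "z \<in> carrier (Gmax a)" and z0: "\<And>k. k \<in> {1..4} - {i, j} \<Longrightarrow> z k = 0"
      by (auto simp: mirror_dual_def)
    have "z i + z j \<in> \<int>"
      using carrier_sum[OF z(2)] sum_two_coordinates[OF ij neq, of z] z0 by simp
    then have zj: "frac (- z i) = z j"
      using carrier_bounds[OF z(2) ij(2)] unfolding frac_unique_iff
      by (metis Ints_minus minus_add_distrib uminus_add_conv_diff add.commute minus_diff_eq diff_minus_eq_add)
    \<comment> \<open>An element realising the least step; pairing \<open>z\<close> with it alone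
      forces p z_i to be integral.\<close>
    obtain g where g: "g \<in> G" "g i = frac (of_int (int ?p) / of_nat (a i))" "g j = 0"
      using modulus_pos(2)[OF ij] unfolding steps_def by blast
    have "(\<Sum>k=1..4. g k * of_nat (a k) * z k) = g i * of_nat (a i) * z i + g j * of_nat (a j) * z j"
      by (rule sum_two_coordinates[OF ij neq]) (use z0 in auto)
    then have "g i * of_nat (a i) * z i \<in> \<int>"
      using z(1) g by (auto simp: mirror_dual_def)
    moreover have "g i * of_nat (a i) * z i =
        of_nat ?p * z i - of_int \<lfloor>of_nat ?p / (of_nat (a i) :: rat)\<rfloor> * (z i * of_nat (a i))"
      unfolding g(2) frac_def using pos[OF ij(1)] by (simp add: field_simps)
    moreover have "of_int \<lfloor>of_nat ?p / (of_nat (a i) :: rat)\<rfloor> * (z i * of_nat (a i)) \<in> \<int>"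
      using carrier_bounds(3)[OF z(2) ij(1)] by (rule Ints_mult[OF Ints_of_int])
    ultimately have "of_nat ?p * z i \<in> \<int>"
      by (metis Ints_add diff_add_cancel)
    then obtain m where m: "of_nat ?p * z i = of_int m" by (auto elim: Ints_cases)
    then have zi: "z i = of_int m / of_nat ?p" using p(1) by (simp add: field_simps)
    have "0 \<le> m" "m < int ?p"
      using carrier_bounds(1,2)[OF z(2) ij(1)] p(1) unfolding zi
      by (simp_all add: field_simps)
    then obtain t where t: "t < ?p" "m = int t" by (metis nat_less_iff int_nat_eq)
    have "z = ?f t"
    proof (rule carrier_eqI[OF z(2)])
      show "?f t \<in> carrier (Gmax a)" using fS[OF t(1)] by (simp add: mirror_dual_def)
      show "z k = ?f t k" if "k \<in> {1..4}" for k
        using that z0[of k] zi zj t(2) by auto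
    qed
    then show "z \<in> ?f ` {..<?p}" using t(1) by blast
  qed (use fS in blast)
  ultimately show ?thesis using card_image[of ?f "{..<?p}"] by simp
qed

text \<open>The summands of the pairing are nonnegative, so it vanishes only for disjoint supports.
  With two zeros each, the supports are complementary: the index pair is the zero set of
  \<open>z\<close> and the support of \<open>z'\<close>.\<close>

lemma roan_pairs_eq:
  "roan_pairs a G = (\<Union>(i, j)\<in>coord_pairs.
    ({z \<in> mirror_dual a G. \<forall>k\<in>{1..4} - {i, j}. z k = 0} - {\<lambda>k\<in>{1..4}. 0})
      \<times> (stab {i, j} - {\<lambda>k\<in>{1..4}. 0}))" (is "_ = (\<Union>(i, j)\<in>_. ?A i j \<times> ?B i j)")
proof -
  interpret M: fermat_symmetries a "mirror_dual a G" by (rule fermat_symmetries_mirror_dual)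
  have "(z', z) \<in> roan_pairs a G \<longleftrightarrow> (\<exists>(i, j)\<in>coord_pairs. z' \<in> ?A i j \<and> z \<in> ?B i j)" for z' z
  proof
    assume "(z', z) \<in> roan_pairs a G"
    then have z': "z' \<in> two_zeros (mirror_dual a G)" and z: "z \<in> two_zeros G"
      and s: "(\<Sum>i=1..4. z' i * of_nat (a i) * z i) = 0"
      by (auto simp: roan_pairs_def)
    have zG: "z \<in> G" "z' \<in> mirror_dual a G" using z z' by (auto simp: two_zeros_def)
    obtain i j where ij: "(i, j) \<in> coord_pairs" "{k \<in> {1..4}. z k = 0} = {i, j}"
    proof -
      have "card {k \<in> {1..4}. z k = 0} = 2" using z by (simp add: two_zeros_def)
      then obtain i j where ij: "{k \<in> {1..4}. z k = 0} = {i, j}" "i \<noteq> j"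
        by (auto simp: card_2_iff)
      then have "i \<in> {1..4}" "j \<in> {1..4}" by blast+
      then have "(i, j) \<in> coord_pairs \<or> (j, i) \<in> coord_pairs"
        using ij(2) unfolding atLeastAtMost_1_4 coord_pairs_def by auto
      then show ?thesis using that ij(1) by (auto simp: insert_commute)
    qed
    have "z' k = 0" if k: "k \<in> {1..4} - {i, j}" for k
    proof -
      have "z' k * of_nat (a k) * z k = 0"
        using s k G_bounds(1)[OF zG(1)] M.G_bounds(1)[OF zG(2)]
          sum_nonneg_eq_0_iff[of "{1..4}" "\<lambda>i. z' i * of_nat (a i) * z i"] by auto
      moreover have "z k \<noteq> 0" using k ij(2) by blast
      ultimately show ?thesis using pos[of k] k by auto
    qed
    moreover have "z' \<noteq> (\<lambda>k\<in>{1..4}. 0)"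
      using z' by (auto simp: two_zeros_def has_level_def)
    ultimately have "z' \<in> ?A i j" using zG(2) by simp
    moreover have "z \<in> ?B i j" using two_zeros_iff[OF ij(1)] ij(2) z by blast
    ultimately show "\<exists>(i, j)\<in>coord_pairs. z' \<in> ?A i j \<and> z \<in> ?B i j" using ij(1) by blast
  next
    assume "\<exists>(i, j)\<in>coord_pairs. z' \<in> ?A i j \<and> z \<in> ?B i j"
    then obtain i j where ij: "(i, j) \<in> coord_pairs" and z': "z' \<in> ?A i j" and z: "z \<in> ?B i j"
      by auto
    obtain k l where kl: "(k, l) \<in> coord_pairs" "{1..4} - {i, j} = {k, l}"
      using coord_pairs_complement[OF ij] .
    have "z' \<in> two_zeros (mirror_dual a G)"
      using z' M.two_zeros_iff[OF kl(1)] unfolding kl(2) M.stab_def by blast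
    moreover have "z \<in> two_zeros G" using z two_zeros_iff[OF ij] by blast
    moreover have "(\<Sum>i=1..4. z' i * of_nat (a i) * z i) = 0"
      using z z' by (intro sum.neutral) (auto simp: stab_def)
    ultimately show "(z', z) \<in> roan_pairs a G" by (simp add: roan_pairs_def)
  qed
  then have "x \<in> roan_pairs a G \<longleftrightarrow> x \<in> (\<Union>(i, j)\<in>coord_pairs. ?A i j \<times> ?B i j)" for x
    by (cases x) (simp only: UN_iff case_prod_unfold mem_Sigma_iff)
  then show ?thesis by (rule Set.set_eqI)
qed

text \<open>The union is disjoint because the zero set of the second component recovers the index
  pair. Each -1 removes the zero vector.\<close>

lemma card_roan_pairs:
  "card (roan_pairs a G) = (\<Sum>(i, j)\<in>coord_pairs. (modulus i j - 1) * (card (stab {i, j}) - 1))"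
proof -
  interpret M: fermat_symmetries a "mirror_dual a G" by (rule fermat_symmetries_mirror_dual)
  let ?A = "\<lambda>i j. {z \<in> mirror_dual a G. \<forall>k\<in>{1..4} - {i, j}. z k = 0} - {\<lambda>k\<in>{1..4}. 0}"
  let ?B = "\<lambda>i j. stab {i, j} - {\<lambda>k\<in>{1..4}. 0}"
  have "card (roan_pairs a G) = (\<Sum>x\<in>coord_pairs. card (case x of (i, j) \<Rightarrow> ?A i j \<times> ?B i j))"
    unfolding roan_pairs_eq
  proof (rule card_UN_disjoint)
    show "finite coord_pairs" by (simp add: coord_pairs_def)
    show "\<forall>x\<in>coord_pairs. finite (case x of (i, j) \<Rightarrow> ?A i j \<times> ?B i j)"
      using finite_G M.finite_G by (auto simp: stab_def)
    show "\<forall>x\<in>coord_pairs. \<forall>y\<in>coord_pairs. x \<noteq> y \<longrightarrow>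
        (case x of (i, j) \<Rightarrow> ?A i j \<times> ?B i j) \<inter> (case y of (i, j) \<Rightarrow> ?A i j \<times> ?B i j) = {}"
    proof (intro ballI impI)
      fix x y assume xy: "x \<in> coord_pairs" "y \<in> coord_pairs" "x \<noteq> y"
      obtain i j k l where ijkl: "x = (i, j)" "y = (k, l)" by (cases x, cases y)
      have "{i, j} \<noteq> {k, l}"
        using xy unfolding ijkl by (auto simp: coord_pairs_def doubleton_eq_iff)
      moreover have "{m \<in> {1..4}. z m = 0} = {i, j}" if "z \<in> ?B i j" for z
        using two_zeros_iff[of i j z] xy(1) that unfolding ijkl by simp
      moreover have "{m \<in> {1..4}. z m = 0} = {k, l}" if "z \<in> ?B k l" for z
        using two_zeros_iff[of k l z] xy(2) that unfolding ijkl by simp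
      ultimately have "?B i j \<inter> ?B k l = {}"
        by (metis (no_types, lifting) disjoint_iff)
      then show "(case x of (i, j) \<Rightarrow> ?A i j \<times> ?B i j) \<inter> (case y of (i, j) \<Rightarrow> ?A i j \<times> ?B i j) = {}"
        unfolding ijkl by auto
    qed
  qed
  also have "\<dots> = (\<Sum>(i, j)\<in>coord_pairs. (modulus i j - 1) * (card (stab {i, j}) - 1))"
  proof (intro sum.cong refl, clarify)
    fix i j assume "(i, j) \<in> coord_pairs"
    then have ij: "i \<in> {1..4}" "j \<in> {1..4}" "i \<noteq> j" using coord_pairsD by blast+
    have "card (?A i j) = modulus i j - 1"
      using card_mirror_dual_stab[OF ij] M.zero_in by (subst card_Diff_singleton) auto
    moreover have "card (?B i j) = card (stab {i, j}) - 1"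
      using zero_in ij by (subst card_Diff_singleton) (auto simp: stab_def)
    ultimately show "card (?A i j \<times> ?B i j) = (modulus i j - 1) * (card (stab {i, j}) - 1)"
      by (simp only: card_cartesian_product)
  qed
  finally show ?thesis .
qed

text \<open>Finiteness of both summands lets \<open>card_Plus\<close> count the twisted
  part.\<close>

lemma finite_D_GT: "finite (D_GT a G)"
  unfolding D_GT_def deformations_def by (simp add: finite_PiE)

lemma finite_roan_pairs: "finite (roan_pairs a G)"
proof -
  interpret M: fermat_symmetries a "mirror_dual a G" by (rule fermat_symmetries_mirror_dual)
  show ?thesis
    using finite_G M.finite_G
    by (intro finite_subset[of "roan_pairs a G" "mirror_dual a G \<times> G"]) (auto simp: roan_pairs_def two_zeros_def)
qed

section \<open>The total count\<close>

theorem card_D_G_D_GT_roan_pairs: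
  "card (D_G a G) + card (D_GT a G) + card (roan_pairs a G) = 20"
proof -
  interpret M: fermat_symmetries a "mirror_dual a G" by (rule fermat_symmetries_mirror_dual)
  \<comment> \<open>Passing to complements, elements of the dual vanishing off {i, j} are those
    supported on it.\<close>
  have "(\<Sum>(i, j)\<in>coord_pairs. card (M.stab {i, j})) = (\<Sum>(i, j)\<in>coord_pairs. modulus i j)"
    unfolding sum_coord_pairs_complement[of "\<lambda>J. card (M.stab J)", symmetric]
  proof (intro sum.cong refl, clarify)
    fix i j assume "(i, j) \<in> coord_pairs"
    then show "card (M.stab ({1..4} - {i, j})) = modulus i j"
      unfolding M.stab_def by (intro card_mirror_dual_stab) (auto dest: coord_pairsD)
  qed
  then have DG: "card (D_G a G) + 5 = (\<Sum>(i, j)\<in>coord_pairs. modulus i j)"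
    using M.card_deformations by (simp add: D_G_def)
  have DGT: "card (D_GT a G) + 5 = (\<Sum>(i, j)\<in>coord_pairs. card (stab {i, j}))"
    using card_deformations by (simp add: D_GT_def)
  \<comment> \<open>For each pair (p-1)(n-1) + p + n = n p + 1; the six ones raise 24 to 30, and the
    two corrections by 5 then give 20.\<close>
  have "(\<Sum>(i, j)\<in>coord_pairs. (modulus i j - 1) * (card (stab {i, j}) - 1))
      + (\<Sum>(i, j)\<in>coord_pairs. modulus i j) + (\<Sum>(i, j)\<in>coord_pairs. card (stab {i, j}))
    = (\<Sum>(i, j)\<in>coord_pairs. card (stab {i, j}) * modulus i j + 1)"
    unfolding sum.distrib[symmetric] case_prod_unfold
  proof (intro sum.cong refl, clarsimp)
    fix i j assume "(i, j) \<in> coord_pairs"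
    then have ij: "i \<in> {1..4}" "j \<in> {1..4}" using coord_pairsD by blast+
    \<comment> \<open>The stabiliser is nonempty, so the subtraction of natural numbers is not
      truncated.\<close>
    have "(\<lambda>k\<in>{1..4}. 0) \<in> stab {i, j}" using zero_in ij by (auto simp: stab_def)
    moreover have "finite (stab {i, j})" using finite_G by (simp add: stab_def)
    ultimately have "card (stab {i, j}) > 0" by (auto simp: card_gt_0_iff)
    then obtain u v where "card (stab {i, j}) = Suc u" "modulus i j = Suc v"
      using modulus_pos(1)[OF ij] gr0_implies_Suc by metis
    then show "(modulus i j - Suc 0) * (card (stab {i, j}) - Suc 0) + modulus i j + card (stab {i, j}) =
      Suc (card (stab {i, j}) * modulus i j)"
      by simp
  qed
  also have "\<dots> = 30"
    using sum_stab_modulus by (simp add: case_prod_unfold sum.distrib coord_pairs_def)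
  finally show ?thesis using DG DGT card_roan_pairs by simp
qed

end

theorem theorem9p2:
  fixes a :: "nat \<Rightarrow> nat" and G :: "(nat \<Rightarrow> rat) set"
  assumes "\<And>i. i \<in> {1..4} \<Longrightarrow> a i > 0"
    and "a 1 \<le> a 2" and "a 2 \<le> a 3" and "a 3 \<le> a 4"
    and "(\<Sum>i=1..4. 1 / of_nat (a i) :: rat) = 1"
    and "subgroup G (Gmax a)" and "G0 a \<subseteq> G"
  shows "vafa_euler a G = 24
    \<and> h11 a G = 20
    \<and> card (D_G a G) + card (D_GT a G) + card (roan_pairs a G) = 20"
proof -
  interpret fermat_symmetries a G by (rule fermat_symmetries.intro) (fact assms)+
  show ?thesis
    using vafa_euler_eq card_D_G_D_GT_roan_pairs finite_D_GT finite_roan_pairs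
    by (simp add: h11_def untwisted_H11_def twisted_H11_def card_Plus)
qed

end
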